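(* Let $E=\mathrm{ind}_m E_m$ be an LF-space with stepwise Schauder basis $(e_j)_{j\in\mathbb{N}}$ and associated backward shift $B$. Then, for an infinite subset $I\subseteq\mathbb{N}$, the following are equivalent. (i) The family $(B^n)_{n\in I}$ is transitive on $E$. (ii) For each $s\in\mathbb{N}_0$ there are $m\in\mathbb{N}$ and a strictly increasing sequence $(j_k)_{k\in\mathbb{N}}$ of elements of $I$ such that $\lim_{k\to\infty}e_{j_k+s}=0$ in $E_m$.
   Context: $\mathbb{N}=\{1,2,\dots\}$, $\mathbb{N}_0=\mathbb{N}\cup\{0\}$, and $\mathbb{K}\in\{\mathbb{R},\mathbb{C}\}$ is the scalar field. LF-space: an inductive spectrum of Fréchet spaces $(E_m)_{m\in\mathbb{N}}$ is an increasing sequence of Fréchet spaces such that each inclusion $E_m\subset E_{m+1}$ is continuous. Its inductive limit (LF-space) $E=\mathrm{ind}_m E_m$ is the union $\bigcup_m E_m$ with the finest locally convex topology making every inclusion $E_m\subset E$ continuous; this topology is assumed to be Hausdorff. Stepwise Schauder basis: a sequence $(e_j)_{j\in\mathbb{N}}$ in $E_1$ which is a Schauder basis of $E_m$ for every $m\in\mathbb{N}$. Associated backward shift: if the linear map on $\mathrm{span}\{e_j: j\in\mathbb{N}\}$ given by $Be_1:=0$, $Be_j:=e_{j-1}$ for $j\ge 2$, extends to a continuous linear map $B:E\to E$, then $B$ is called the backward shift associated with $(e_j)_j$. Saying that $E$ has associated backward shift $B$ means that this continuous extension exists. Transitivity of a family: for an infinite set $I\subseteq\mathbb{N}$, a family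 $(T_n)_{n\in I}$ of continuous linear operators on $E$ is transitive if for every pair of non-empty open subsets $U,V\subseteq E$ there is $n\in I$ with $T_n(U)\cap V\neq\emptyset$. *)

theory Defs
  imports "HOL-Analysis.Analysis"
begin

text \<open>
  All spaces are linear subspaces of one ambient vector space over \<open>'k\<close> with scalar
  multiplication \<open>scl\<close>; a topology on such a subspace is an abstract topology whose
  \<open>topspace\<close> is the subspace. Up to isomorphism (of real normed algebras), the types of class
  \<open>real_normed_field\<close> are exactly \<open>real\<close> and \<open>complex\<close> (Gelfand-Mazur), so \<open>'k\<close> stands for the
  scalar field \<open>\<real>\<close> or \<open>\<complex>\<close>.
\<close>

locale tvs = vector_space scl
  for scl :: "'k::{real_normed_field,banach} \<Rightarrow> 'a::ab_group_add \<Rightarrow> 'a" +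
  fixes T :: "'a topology"
  assumes subspace_topspace: "subspace (topspace T)"
    and continuous_add: "continuous_map (prod_topology T T) T (\<lambda>(x, y). x + y)"
    and continuous_scale: "continuous_map (prod_topology euclidean T) T (\<lambda>(c, x). scl c x)"

text \<open>Convexity with respect to \<open>scl\<close>: the library's \<open>convex\<close> needs the type class
  \<open>real_vector\<close>.\<close>

definition convex_wrt :: "('k::real_normed_field \<Rightarrow> 'a::ab_group_add \<Rightarrow> 'a) \<Rightarrow> 'a set \<Rightarrow> bool"
  where "convex_wrt scl C \<longleftrightarrow>
    (\<forall>x\<in>C. \<forall>y\<in>C. \<forall>u\<ge>0. \<forall>v\<ge>0. u + v = 1 \<longrightarrow> scl (of_real u) x + scl (of_real v) y \<in> C)"

locale locally_convex_tvs = tvs scl T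
  for scl :: "'k::{real_normed_field,banach} \<Rightarrow> 'a::ab_group_add \<Rightarrow> 'a"
    and T :: "'a topology" +
  assumes locally_convex: "neighbourhood_base_at 0 (convex_wrt scl) T"

locale frechet_space = locally_convex_tvs scl T
  for scl :: "'k::{real_normed_field,banach} \<Rightarrow> 'a::ab_group_add \<Rightarrow> 'a"
    and T :: "'a topology" +
  assumes complete_invariant_metric:
    "\<exists>d. Metric_space (topspace T) d \<and>
         Metric_space.mtopology (topspace T) d = T \<and>
         Metric_space.mcomplete (topspace T) d \<and>
         (\<forall>x\<in>topspace T. \<forall>y\<in>topspace T. \<forall>z\<in>topspace T. d (x + z) (y + z) = d x y)"

text \<open>Throughout, spectra \<open>E\<close> and bases \<open>e\<close> are indexed by \<open>{1, 2, \<dots>}\<close>; the values \<open>E 0\<close> and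
  \<open>e 0\<close> are irrelevant.\<close>

definition inductive_spectrum ::
  "('k::{real_normed_field,banach} \<Rightarrow> 'a::ab_group_add \<Rightarrow> 'a) \<Rightarrow> (nat \<Rightarrow> 'a topology) \<Rightarrow> bool"
  where "inductive_spectrum scl E \<longleftrightarrow>
    (\<forall>m\<ge>1. frechet_space scl (E m) \<and>
            topspace (E m) \<subseteq> topspace (E (Suc m)) \<and>
            continuous_map (E m) (E (Suc m)) (\<lambda>x. x))"

definition inductive_limit ::
  "('k::{real_normed_field,banach} \<Rightarrow> 'a::ab_group_add \<Rightarrow> 'a) \<Rightarrow> (nat \<Rightarrow> 'a topology) \<Rightarrow>
    'a topology \<Rightarrow> bool"
  where "inductive_limit scl E T \<longleftrightarrow>
    topspace T = (\<Union>m\<in>{1..}. topspace (E m)) \<and>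
    locally_convex_tvs scl T \<and>
    (\<forall>m\<ge>1. continuous_map (E m) T (\<lambda>x. x)) \<and>
    (\<forall>T'. topspace T' = (\<Union>m\<in>{1..}. topspace (E m)) \<and>
          locally_convex_tvs scl T' \<and>
          (\<forall>m\<ge>1. continuous_map (E m) T' (\<lambda>x. x)) \<longrightarrow>
          (\<forall>U. openin T' U \<longrightarrow> openin T U))"

definition lf_space ::
  "('k::{real_normed_field,banach} \<Rightarrow> 'a::ab_group_add \<Rightarrow> 'a) \<Rightarrow> (nat \<Rightarrow> 'a topology) \<Rightarrow>
    'a topology \<Rightarrow> bool"
  where "lf_space scl E T \<longleftrightarrow>
    inductive_spectrum scl E \<and> inductive_limit scl E T \<and> Hausdorff_space T"

definition basis_expansion ::
  "('k::{real_normed_field,banach} \<Rightarrow> 'a::ab_group_add \<Rightarrow> 'a) \<Rightarrow> 'a topology \<Rightarrow>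
    (nat \<Rightarrow> 'a) \<Rightarrow> (nat \<Rightarrow> 'k) \<Rightarrow> 'a \<Rightarrow> bool"
  where "basis_expansion scl T e a x \<longleftrightarrow>
    limitin T (\<lambda>n. \<Sum>j=1..n. scl (a j) (e j)) x sequentially"

definition schauder_basis ::
  "('k::{real_normed_field,banach} \<Rightarrow> 'a::ab_group_add \<Rightarrow> 'a) \<Rightarrow> 'a topology \<Rightarrow>
    (nat \<Rightarrow> 'a) \<Rightarrow> bool"
  where "schauder_basis scl T e \<longleftrightarrow>
    (\<forall>j\<ge>1. e j \<in> topspace T) \<and>
    (\<forall>x\<in>topspace T. \<exists>a. basis_expansion scl T e a x \<and>
       (\<forall>b. basis_expansion scl T e b x \<longrightarrow> (\<forall>j\<ge>1. b j = a j)))"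

definition stepwise_schauder_basis ::
  "('k::{real_normed_field,banach} \<Rightarrow> 'a::ab_group_add \<Rightarrow> 'a) \<Rightarrow> (nat \<Rightarrow> 'a topology) \<Rightarrow>
    (nat \<Rightarrow> 'a) \<Rightarrow> bool"
  where "stepwise_schauder_basis scl E e \<longleftrightarrow>
    (\<forall>j\<ge>1. e j \<in> topspace (E 1)) \<and> (\<forall>m\<ge>1. schauder_basis scl (E m) e)"

text \<open>\<open>B\<close> is a continuous linear operator on the space \<open>T\<close>; being linear, it extends the shift on
  the span of the \<open>e j\<close> as soon as it has the right values at the \<open>e j\<close>. Values of \<open>B\<close> outside
  \<open>topspace T\<close> are irrelevant.\<close>

definition backward_shift ::
  "('k::{real_normed_field,banach} \<Rightarrow> 'a::ab_group_add \<Rightarrow> 'a) \<Rightarrow> 'a topology \<Rightarrow>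
    (nat \<Rightarrow> 'a) \<Rightarrow> ('a \<Rightarrow> 'a) \<Rightarrow> bool"
  where "backward_shift scl T e B \<longleftrightarrow>
    continuous_map T T B \<and>
    (\<forall>x\<in>topspace T. \<forall>y\<in>topspace T. B (x + y) = B x + B y) \<and>
    (\<forall>c. \<forall>x\<in>topspace T. B (scl c x) = scl c (B x)) \<and>
    B (e 1) = 0 \<and> (\<forall>j\<ge>2. B (e j) = e (j - 1))"

definition transitive_family ::
  "'a topology \<Rightarrow> (nat \<Rightarrow> 'a \<Rightarrow> 'a) \<Rightarrow> nat set \<Rightarrow> bool"
  where "transitive_family T F I \<longleftrightarrow>
    (\<forall>U V. openin T U \<and> U \<noteq> {} \<and> openin T V \<and> V \<noteq> {} \<longrightarrow> (\<exists>n\<in>I. F n ` U \<inter> V \<noteq> {}))"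

end

theory Submission
  imports Defs
begin

text \<open>
  Suppose that for every \<open>s\<close> some subsequence of \<open>e (n + s)\<close>, \<open>n \<in> I\<close>, tends to \<open>0\<close> in a step. Finite
  combinations \<open>u\<close>, \<open>v\<close> of the first \<open>N\<close> basis vectors are dense. Applying powers of the continuous
  operator \<open>B\<close> to a null sequence \<open>e (j\<^sub>k + N)\<close> gives \<open>e (j\<^sub>k + i) \<rightarrow> 0\<close> for all \<open>i \<le> N\<close>; hence the
  forward shift of \<open>v\<close> by \<open>n = j\<^sub>k\<close> tends to \<open>0\<close>. Added to \<open>u\<close> it gives a vector near \<open>u\<close> that
  \<open>B ^^ n\<close> maps to \<open>v\<close> as soon as \<open>n \<ge> N\<close> (lemma \<open>null_subsequence_imp_transitive\<close>).

  Conversely, suppose that for some \<open>s\<close> there is no such null subsequence. In each step the vectors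
  \<open>e (n + s)\<close>, \<open>n \<in> I\<close>, then stay outside a neighbourhood of \<open>0\<close>
  (\<open>bounded_away_or_null_subsequence\<close>). The partial sum projections of a Schauder basis of a
  Frechet space are equicontinuous (\<open>psum_equicontinuous\<close>), so the terms of the expansion of a small
  vector are uniformly small, and therefore the coefficient functionals with indices \<open>n + s\<close> are
  equicontinuous on each step. The supremum of their moduli is a seminorm that is continuous on each
  step. Since the limit carries the finest locally convex topology with continuous inclusions, the
  seminorm is continuous on the limit (\<open>lcoef_equicontinuous\<close>), and this contradicts transitivity,
  because \<open>B ^^ n\<close> moves the coefficient of index \<open>n + s + 1\<close> to the fixed index \<open>s + 1\<close>
  (\<open>transitive_imp_null_subsequence\<close>).

  Equicontinuity of the projections is Banach's theorem on the continuity of coefficient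
  functionals. It is an open mapping argument for the finer metric
  \<open>sup\<^sub>n nrm (psum n x)\<close>, carried out directly: the Baire category theorem shows that the closures
  of its balls are neighbourhoods of \<open>0\<close>, and successive approximation removes the closure.
\<close>

section \<open>Topological vector spaces\<close>

context tvs
begin

lemma topspace_0: "0 \<in> topspace T"
  using subspace_topspace by (rule subspace_0)

lemma topspace_add: "x \<in> topspace T \<Longrightarrow> y \<in> topspace T \<Longrightarrow> x + y \<in> topspace T"
  using subspace_topspace by (rule subspace_add)

lemma topspace_diff: "x \<in> topspace T \<Longrightarrow> y \<in> topspace T \<Longrightarrow> x - y \<in> topspace T"
  using subspace_topspace by (rule subspace_diff)

lemma topspace_scale: "x \<in> topspace T \<Longrightarrow> scl c x \<in> topspace T"
  using subspace_topspace by (rule subspace_scale)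

lemma topspace_sum: "(\<And>i. i \<in> A \<Longrightarrow> f i \<in> topspace T) \<Longrightarrow> sum f A \<in> topspace T"
  using subspace_topspace by (rule subspace_sum)

lemma limitin_add:
  assumes "limitin T f l F" "limitin T g l' F"
  shows "limitin T (\<lambda>x. f x + g x) (l + l') F"
proof -
  have "limitin (prod_topology T T) (\<lambda>x. (f x, g x)) (l, l') F"
    using assms by (simp add: limitin_pairwise o_def)
  from continuous_map_limit[OF continuous_add this] show ?thesis
    by (simp add: o_def)
qed

lemma limitin_scale:
  assumes "(c \<longlongrightarrow> c') F" "limitin T f l F"
  shows "limitin T (\<lambda>x. scl (c x) (f x)) (scl c' l) F"
proof -
  have "limitin (prod_topology euclidean T) (\<lambda>x. (c x, f x)) (c', l) F"
    using assms by (simp add: limitin_pairwise o_def)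
  from continuous_map_limit[OF continuous_scale this] show ?thesis
    by (simp add: o_def)
qed

lemma limitin_sum_0:
  assumes "finite A" "\<And>i. i \<in> A \<Longrightarrow> limitin T (f i) 0 F"
  shows "limitin T (\<lambda>x. \<Sum>i\<in>A. f i x) 0 F"
  using assms
proof (induction A rule: finite_induct)
  case empty
  then show ?case by (simp add: topspace_0)
next
  case (insert a A)
  then have "limitin T (\<lambda>x. f a x + (\<Sum>i\<in>A. f i x)) (0 + 0) F"
    by (intro limitin_add) auto
  with insert show ?case by simp
qed

lemma openin_translation:
  assumes "openin T U" "a \<in> topspace T"
  shows "openin T {y \<in> topspace T. y - a \<in> U}"
proof -
  have "continuous_map T (prod_topology T T) (\<lambda>y. (y, - a))"
    using assms(2) subspace_neg[OF subspace_topspace] by (simp add: continuous_map_pairwise o_def)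
  from continuous_map_compose[OF this continuous_add]
  have "continuous_map T T (\<lambda>y. y - a)"
    by (simp add: o_def)
  then show ?thesis
    using assms(1) by (rule openin_continuous_map_preimage)
qed

end

section \<open>Complete spaces with an invariant metric\<close>

text \<open>A Frechet space together with a chosen complete translation invariant metric; local
  convexity plays no role in this part of the argument.\<close>

locale invariant_metric_tvs = tvs scl T + Metric_space "topspace T" d
  for scl :: "'k::{real_normed_field,banach} \<Rightarrow> 'a::ab_group_add \<Rightarrow> 'a"
    and T :: "'a topology" and d :: "'a \<Rightarrow> 'a \<Rightarrow> real" +
  assumes mtopology_eq: "mtopology = T"
    and mcomplete: "mcomplete"
    and invariant: "\<And>x y z. x \<in> topspace T \<Longrightarrow> y \<in> topspace T \<Longrightarrow> z \<in> topspace T \<Longrightarrow>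
      d (x + z) (y + z) = d x y"
begin

abbreviation X where "X \<equiv> topspace T"

text \<open>The distance to \<open>0\<close>; it is subadditive, but not homogeneous in general.\<close>

definition nrm :: "'a \<Rightarrow> real" where "nrm x = d x 0"

lemma d_eq_nrm: assumes "x \<in> X" "y \<in> X" shows "d x y = nrm (x - y)"
  using invariant[of "x - y" 0 y] assms topspace_0 topspace_diff by (simp add: nrm_def)

lemma nrm_0 [simp]: "nrm 0 = 0"
  by (simp add: nrm_def topspace_0)

lemma nrm_pos: "x \<in> X \<Longrightarrow> x \<noteq> 0 \<Longrightarrow> 0 < nrm x"
  using mdist_pos_eq[of x 0] by (simp add: nrm_def topspace_0)

lemma nrm_minus_commute: assumes "x \<in> X" "y \<in> X" shows "nrm (x - y) = nrm (y - x)"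
  using assms d_eq_nrm[of x y] d_eq_nrm[of y x] commute[of x y] by simp

lemma nrm_add: assumes "x \<in> X" "y \<in> X" shows "nrm (x + y) \<le> nrm x + nrm y"
proof -
  have "d (x + y) 0 \<le> d (x + y) y + d y 0"
    using assms topspace_0 topspace_add by (intro triangle) auto
  moreover have "d (x + y) y = nrm x"
    using d_eq_nrm[of "x + y" y] assms topspace_add by simp
  ultimately show ?thesis by (simp add: nrm_def)
qed

lemma nrm_diff: assumes "x \<in> X" "y \<in> X" shows "nrm (x - y) \<le> nrm x + nrm y"
proof -
  have "nrm (x - y) \<le> nrm x + nrm (0 - y)"
    using nrm_add[of x "0 - y"] assms topspace_0 topspace_diff[of 0 y] by simp
  also have "nrm (0 - y) = nrm y"
    using nrm_minus_commute[of 0 y] assms topspace_0 by simp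
  finally show ?thesis .
qed

lemma openin_nrm: "openin T U \<longleftrightarrow> U \<subseteq> X \<and> (\<forall>x\<in>U. \<exists>r>0. \<forall>y\<in>X. nrm (y - x) < r \<longrightarrow> y \<in> U)"
proof -
  have "openin T U \<longleftrightarrow> U \<subseteq> X \<and> (\<forall>x. x \<in> U \<longrightarrow> (\<exists>r>0. mball x r \<subseteq> U))"
    using openin_mtopology[of U] by (simp only: mtopology_eq)
  moreover have "mball x r \<subseteq> U \<longleftrightarrow> (\<forall>y\<in>X. nrm (y - x) < r \<longrightarrow> y \<in> U)" if "x \<in> X" for x r
    using that d_eq_nrm by (auto simp: commute)
  ultimately show ?thesis by (metis subsetD)
qed

lemma openin_nrm_ball: "openin T {x \<in> X. nrm x < r}"
proof -
  have "{x \<in> X. nrm x < r} = mball 0 r"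
    by (auto simp: nrm_def commute topspace_0)
  then show ?thesis using openin_mball[of 0 r] by (simp only: mtopology_eq)
qed

lemma limitin_nrm:
  "limitin T f l F \<longleftrightarrow> l \<in> X \<and> (\<forall>r>0. \<forall>\<^sub>F n in F. f n \<in> X \<and> nrm (f n - l) < r)"
proof -
  have "limitin T f l F \<longleftrightarrow> l \<in> X \<and> (\<forall>r>0. \<forall>\<^sub>F n in F. f n \<in> X \<and> d (f n) l < r)"
    using limitin_metric[of f l F] by (simp only: mtopology_eq)
  then show ?thesis
    using d_eq_nrm by (auto elim!: eventually_mono)
qed

lemma limitin_nrm_less:
  assumes "limitin T f l F" "r > 0"
  shows "\<forall>\<^sub>F n in F. nrm (f n - l) < r"
proof -
  have "\<forall>\<^sub>F n in F. f n \<in> X \<and> nrm (f n - l) < r"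
    using assms unfolding limitin_nrm by blast
  then show ?thesis by (rule eventually_mono) simp
qed

lemma Cauchy_nrm_limit:
  assumes "\<And>n. f n \<in> X" "\<And>r. r > 0 \<Longrightarrow> \<exists>N. \<forall>m\<ge>N. \<forall>n\<ge>N. nrm (f m - f n) < r"
  obtains l where "limitin T f l sequentially"
proof -
  have "MCauchy f"
    unfolding MCauchy_def using assms by (auto simp: d_eq_nrm)
  then show thesis using mcomplete that by (auto simp: mcomplete_def mtopology_eq)
qed

lemma scale_continuous_at:
  assumes "x \<in> X" "r > 0"
  shows "\<exists>\<eta>>0. \<exists>\<rho>>0. \<forall>c' y. norm (c' - c) < \<eta> \<and> y \<in> X \<and> nrm (y - x) < \<rho> \<longrightarrow>
           nrm (scl c' y - scl c x) < r"
proof -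
  define P where "P = {p \<in> topspace (prod_topology euclidean T).
    (\<lambda>(c, x). scl c x) p \<in> {y \<in> X. y - scl c x \<in> {z \<in> X. nrm z < r}}}"
  have "openin (prod_topology euclidean T) P"
    unfolding P_def using assms topspace_scale
    by (intro openin_continuous_map_preimage[OF continuous_scale] openin_translation openin_nrm_ball) auto
  moreover have "(c, x) \<in> P"
    unfolding P_def using assms topspace_scale topspace_0 by auto
  ultimately obtain U V where UV: "open U" "openin T V" "c \<in> U" "x \<in> V" "U \<times> V \<subseteq> P"
    unfolding openin_prod_topology_alt by force
  obtain \<eta> where \<eta>: "\<eta> > 0" "\<And>c'. norm (c' - c) < \<eta> \<Longrightarrow> c' \<in> U"
    using UV(1,3) by (auto simp: open_dist dist_norm)
  obtain \<rho> where \<rho>: "\<rho> > 0" "\<And>y. y \<in> X \<Longrightarrow> nrm (y - x) < \<rho> \<Longrightarrow> y \<in> V"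
    using UV(2,4) unfolding openin_nrm by blast
  have "nrm (scl c' y - scl c x) < r" if "norm (c' - c) < \<eta>" "y \<in> X" "nrm (y - x) < \<rho>" for c' y
  proof -
    have "(c', y) \<in> P" using UV(5) \<eta>(2) \<rho>(2) that by blast
    then show ?thesis by (simp add: P_def)
  qed
  with \<eta>(1) \<rho>(1) show ?thesis by blast
qed

text \<open>Multiplication by a bounded set of scalars is equicontinuous at \<open>0\<close>.\<close>

lemma bounded_scale:
  assumes "M > 0" "r > 0"
  obtains \<delta> where "\<delta> > 0" "\<And>t y. norm t \<le> M \<Longrightarrow> y \<in> X \<Longrightarrow> nrm y < \<delta> \<Longrightarrow> nrm (scl t y) < r"
proof -
  obtain \<eta> \<rho> where \<eta>: "\<eta> > 0" "\<rho> > 0"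
    "\<And>c y. norm c < \<eta> \<Longrightarrow> y \<in> X \<Longrightarrow> nrm y < \<rho> \<Longrightarrow> nrm (scl c y) < r"
    using scale_continuous_at[of 0 r 0] assms(2) topspace_0 by auto
  define k :: 'k where "k = of_real (2 * M / \<eta>)"
  have k: "k \<noteq> 0" "norm k = 2 * M / \<eta>" using assms \<eta>(1) by (auto simp: k_def norm_divide norm_mult)
  obtain \<delta> where \<delta>: "\<delta> > 0" "\<And>y. y \<in> X \<Longrightarrow> nrm y < \<delta> \<Longrightarrow> nrm (scl k y) < \<rho>"
    using scale_continuous_at[of 0 \<rho> k] \<eta>(2) topspace_0 by (metis diff_self diff_zero norm_zero scale_zero_right)
  have "nrm (scl t y) < r" if "norm t \<le> M" "y \<in> X" "nrm y < \<delta>" for t y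
  proof -
    have "norm (t / k) < \<eta>"
      using that(1) assms(1) \<eta>(1) by (simp add: norm_divide k field_simps)
    then have "nrm (scl (t / k) (scl k y)) < r"
      using that \<delta> topspace_scale by (intro \<eta>(3)) auto
    then show ?thesis using k by simp
  qed
  with \<delta>(1) show thesis using that by blast
qed

lemma small_scale:
  assumes "x \<in> X" "r > 0"
  shows "\<exists>\<eta>>0. \<forall>c. norm c < \<eta> \<longrightarrow> nrm (scl c x) < r"
  using scale_continuous_at[OF assms, of 0] by (auto simp: assms(1))

lemma convergent_bounded:
  assumes "limitin T f l sequentially" "\<And>n. f n \<in> X" "r > 0"
  shows "\<exists>\<eta>>0. \<forall>n c. norm c < \<eta> \<longrightarrow> nrm (scl c (f n)) < r"
proof -
  have l: "l \<in> X" using assms(1) by (simp add: limitin_nrm)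
  obtain \<eta> \<rho> where \<eta>: "\<eta> > 0" "\<rho> > 0"
    "\<And>c y. norm c < \<eta> \<Longrightarrow> y \<in> X \<Longrightarrow> nrm (y - l) < \<rho> \<Longrightarrow> nrm (scl c y) < r"
    using scale_continuous_at[OF l assms(3), of 0] by auto
  obtain N where N: "\<And>n. n \<ge> N \<Longrightarrow> nrm (f n - l) < \<rho>"
    using assms(1) \<eta>(2) unfolding limitin_nrm eventually_sequentially by blast
  have "\<exists>\<eta>>0. \<forall>n<K. \<forall>c. norm c < \<eta> \<longrightarrow> nrm (scl c (f n)) < r" for K
  proof (induction K)
    case 0
    show ?case by (auto intro: exI[of _ 1])
  next
    case (Suc K)
    then obtain \<eta>1 where "\<eta>1 > 0" "\<forall>n<K. \<forall>c. norm c < \<eta>1 \<longrightarrow> nrm (scl c (f n)) < r" by blast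
    moreover obtain \<eta>2 where "\<eta>2 > 0" "\<forall>c. norm c < \<eta>2 \<longrightarrow> nrm (scl c (f K)) < r"
      using small_scale[OF assms(2,3)] by blast
    ultimately show ?case
      by (intro exI[of _ "min \<eta>1 \<eta>2"]) (auto simp: less_Suc_eq)
  qed
  then obtain \<eta>' where "\<eta>' > 0" "\<forall>n<N. \<forall>c. norm c < \<eta>' \<longrightarrow> nrm (scl c (f n)) < r" by blast
  then show ?thesis
    using \<eta> N assms(2) by (intro exI[of _ "min \<eta> \<eta>'"]) (metis min_less_iff_conj not_less)
qed

text \<open>If a multiple \<open>c y\<close> is small and \<open>y\<close> is not, then \<open>c\<close> is small, uniformly in \<open>y\<close>.\<close>

lemma scalar_small:
  assumes "r > 0" "\<epsilon> > 0"
  obtains \<delta> where "\<delta> > 0"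
    "\<And>c y. y \<in> X \<Longrightarrow> nrm y \<ge> r \<Longrightarrow> nrm (scl c y) < \<delta> \<Longrightarrow> norm c < \<epsilon>"
proof -
  obtain \<delta> where \<delta>: "\<delta> > 0"
    "\<And>t y. norm t \<le> 1 / \<epsilon> \<Longrightarrow> y \<in> X \<Longrightarrow> nrm y < \<delta> \<Longrightarrow> nrm (scl t y) < r"
    using bounded_scale[of "1 / \<epsilon>" r] assms by auto
  have "norm c < \<epsilon>" if "y \<in> X" "nrm y \<ge> r" "nrm (scl c y) < \<delta>" for c y
  proof (rule ccontr)
    assume "\<not> norm c < \<epsilon>"
    then have "\<epsilon> \<le> norm c" by simp
    with assms(2) have "norm (1 / c) \<le> 1 / \<epsilon>" and "c \<noteq> 0"
      by (auto simp: norm_divide frac_le)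
    then have "nrm (scl (1 / c) (scl c y)) < r"
      using that topspace_scale by (intro \<delta>(2)) auto
    with \<open>c \<noteq> 0\<close> that(2) show False by simp
  qed
  with \<delta>(1) show thesis using that by blast
qed

end

text \<open>A family of nonzero vectors without a null subsequence misses a ball around \<open>0\<close>: if every
  ball contained one of the vectors, it would contain some with arbitrarily large index, since
  finitely many nonzero vectors miss a smaller ball.\<close>

lemma (in invariant_metric_tvs) bounded_away_or_null_subsequence:
  fixes f :: "nat \<Rightarrow> 'a"
  assumes "\<And>n. n \<in> I \<Longrightarrow> f n \<in> X \<and> f n \<noteq> 0"
    and "\<nexists>j. strict_mono j \<and> range j \<subseteq> I \<and> limitin T (\<lambda>k. f (j k)) 0 sequentially"
  shows "\<exists>r>0. \<forall>n\<in>I. nrm (f n) \<ge> r"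
proof (rule ccontr)
  assume "\<not> ?thesis"
  then have small: "\<exists>n\<in>I. nrm (f n) < r" if "r > 0" for r
    using that by (meson not_le)
  have step: "\<exists>n\<in>I. n > N \<and> nrm (f n) < r" if "r > 0" for r N
  proof -
    define A where "A = insert r ((\<lambda>n. nrm (f n)) ` {n\<in>I. n \<le> N})"
    have "finite {n\<in>I. n \<le> N}" by (rule finite_subset[of _ "{..N}"]) auto
    then have A: "finite A" "A \<noteq> {}" "\<And>a. a \<in> A \<Longrightarrow> a > 0"
      using that assms(1) nrm_pos by (auto simp: A_def)
    then have "Min A > 0" by (meson Min_in)
    then obtain n where n: "n \<in> I" "nrm (f n) < Min A" using small by blast
    have "nrm (f n) < r" using n(2) A by (auto simp: A_def)
    moreover have "n > N"
    proof (rule ccontr)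
      assume "\<not> n > N"
      then have "nrm (f n) \<in> A" using n(1) by (auto simp: A_def)
      then show False using n(2) A by (meson Min_le not_le)
    qed
    ultimately show ?thesis using n(1) by blast
  qed
  have "\<exists>j. \<forall>k. (j k \<in> I \<and> nrm (f (j k)) < 1 / real (Suc k)) \<and> j k < j (Suc k)"
  proof (rule dependent_nat_choice)
    show "\<exists>x. x \<in> I \<and> nrm (f x) < 1 / real (Suc 0)"
      using small[of 1] by auto
  next
    fix x k
    show "\<exists>y. (y \<in> I \<and> nrm (f y) < 1 / real (Suc (Suc k))) \<and> x < y"
      using step[of "1 / real (Suc (Suc k))" x] by auto
  qed
  then obtain j where j: "\<And>k. j k \<in> I" "\<And>k. nrm (f (j k)) < 1 / real (Suc k)" "\<And>k. j k < j (Suc k)"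
    by blast
  have "limitin T (\<lambda>k. f (j k)) 0 sequentially"
    unfolding limitin_nrm
  proof (intro conjI allI impI topspace_0)
    fix r :: real assume "r > 0"
    then obtain N where N: "1 / real (Suc N) < r"
      using reals_Archimedean by (auto simp: inverse_eq_divide)
    have "nrm (f (j n)) < r" if "n \<ge> N" for n
    proof -
      have "1 / real (Suc n) \<le> 1 / real (Suc N)" using that by (simp add: frac_le)
      then show ?thesis using j(2)[of n] N by linarith
    qed
    then show "\<forall>\<^sub>F n in sequentially. f (j n) \<in> X \<and> nrm (f (j n) - 0) < r"
      using j(1) assms(1) by (auto intro!: eventually_sequentiallyI[of N])
  qed
  moreover have "strict_mono j" using j(3) by (simp add: strict_mono_Suc_iff)
  moreover have "range j \<subseteq> I" using j(1) by blast
  ultimately have "strict_mono j \<and> range j \<subseteq> I \<and> limitin T (\<lambda>k. f (j k)) 0 sequentially"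
    by simp
  then show False by (rule notE[OF assms(2), OF exI])
qed

lemma (in frechet_space) invariant_metric:
  obtains d where "invariant_metric_tvs scl T d"
proof -
  obtain d where "Metric_space (topspace T) d" "Metric_space.mtopology (topspace T) d = T"
    "Metric_space.mcomplete (topspace T) d"
    "\<forall>x\<in>topspace T. \<forall>y\<in>topspace T. \<forall>z\<in>topspace T. d (x + z) (y + z) = d x y"
    using complete_invariant_metric by blast
  then have "invariant_metric_tvs scl T d"
    by (intro invariant_metric_tvs.intro invariant_metric_tvs_axioms.intro tvs_axioms) auto
  then show thesis by (rule that)
qed

section \<open>Schauder bases and their partial sum projections\<close>

text \<open>A topological vector space with a Schauder basis. The coefficients of a vector are chosen as
  some expansion; the uniqueness part of the definition of a basis makes them linear in the vector.
  Their values at the index \<open>0\<close> are arbitrary, so all statements are restricted to \<open>j \<ge> 1\<close>.\<close>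

locale schauder_tvs = tvs scl T
  for scl :: "'k::{real_normed_field,banach} \<Rightarrow> 'a::ab_group_add \<Rightarrow> 'a"
    and T :: "'a topology" +
  fixes e :: "nat \<Rightarrow> 'a"
  assumes basis: "schauder_basis scl T e"
begin

lemma e_in: "j \<ge> 1 \<Longrightarrow> e j \<in> topspace T"
  using basis by (simp add: schauder_basis_def)

definition coef :: "'a \<Rightarrow> nat \<Rightarrow> 'k" where
  "coef x = (SOME a. basis_expansion scl T e a x)"

text \<open>The projection of a vector to the span of the first \<open>n\<close> basis vectors.\<close>

definition psum :: "nat \<Rightarrow> 'a \<Rightarrow> 'a" where
  "psum n x = (\<Sum>j=1..n. scl (coef x j) (e j))"

lemma expansion_in: "basis_expansion scl T e a x \<Longrightarrow> x \<in> topspace T"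
  by (simp add: basis_expansion_def limitin_topspace)

lemma coef_expansion: "x \<in> topspace T \<Longrightarrow> basis_expansion scl T e (coef x) x"
  using basis someI_ex[of "\<lambda>a. basis_expansion scl T e a x"]
  unfolding coef_def schauder_basis_def by blast

lemma coef_unique:
  assumes "basis_expansion scl T e a x" "j \<ge> 1"
  shows "coef x j = a j"
proof -
  obtain b where "\<forall>a. basis_expansion scl T e a x \<longrightarrow> (\<forall>j\<ge>1. a j = b j)"
    using basis expansion_in[OF assms(1)] unfolding schauder_basis_def by blast
  then show ?thesis
    using assms coef_expansion[OF expansion_in[OF assms(1)]] by metis
qed

lemma coef_add:
  assumes "x \<in> topspace T" "y \<in> topspace T" "j \<ge> 1"
  shows "coef (x + y) j = coef x j + coef y j"
proof -
  have "basis_expansion scl T e (\<lambda>j. coef x j + coef y j) (x + y)"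
    using limitin_add[OF coef_expansion[OF assms(1), unfolded basis_expansion_def]
        coef_expansion[OF assms(2), unfolded basis_expansion_def]]
    by (simp add: basis_expansion_def scale_left_distrib sum.distrib)
  then show ?thesis using assms(3) by (rule coef_unique)
qed

lemma coef_scale:
  assumes "x \<in> topspace T" "j \<ge> 1"
  shows "coef (scl c x) j = c * coef x j"
proof -
  have "basis_expansion scl T e (\<lambda>j. c * coef x j) (scl c x)"
    using limitin_scale[OF tendsto_const[of c] coef_expansion[OF assms(1), unfolded basis_expansion_def]]
    by (simp add: basis_expansion_def scale_sum_right)
  then show ?thesis using assms(2) by (rule coef_unique)
qed

lemma expansion_e: "j \<ge> 1 \<Longrightarrow> basis_expansion scl T e (\<lambda>i. if i = j then 1 else 0) (e j)"
proof -
  assume j: "j \<ge> 1"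
  have *: "(\<Sum>i=1..n. scl (if i = j then 1 else 0) (e i)) = e j" if "n \<ge> j" for n
  proof -
    have "(\<Sum>i=1..n. scl (if i = j then 1 else 0) (e i)) = (\<Sum>i=1..n. if i = j then e i else 0)"
      by (intro sum.cong) auto
    then show ?thesis using j that by simp
  qed
  show ?thesis
    unfolding basis_expansion_def using j
    by (intro limitin_eventually eventually_sequentiallyI[of j] *) (auto simp: e_in)
qed

lemma coef_e: "i \<ge> 1 \<Longrightarrow> j \<ge> 1 \<Longrightarrow> coef (e j) i = (if i = j then 1 else 0)"
  using coef_unique[OF expansion_e] by simp

lemma expansion_0: "basis_expansion scl T e (\<lambda>_. 0) 0"
  by (simp add: basis_expansion_def topspace_0)

lemma coef_0: "j \<ge> 1 \<Longrightarrow> coef 0 j = 0"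
  using coef_unique[OF expansion_0] by simp

lemma e_nonzero: assumes "j \<ge> 1" shows "e j \<noteq> 0"
proof
  assume "e j = 0"
  then show False
    using coef_e[OF assms assms] coef_0[OF assms] by simp
qed

lemma psum_in: "psum n x \<in> topspace T"
  unfolding psum_def by (intro topspace_sum topspace_scale e_in) auto

lemma psum_Suc: "psum (Suc n) x = psum n x + scl (coef x (Suc n)) (e (Suc n))"
  by (simp add: psum_def)

lemma psum_add: "x \<in> topspace T \<Longrightarrow> y \<in> topspace T \<Longrightarrow> psum n (x + y) = psum n x + psum n y"
  by (simp add: psum_def coef_add scale_left_distrib sum.distrib)

lemma psum_scale: "x \<in> topspace T \<Longrightarrow> psum n (scl c x) = scl c (psum n x)"
  by (simp add: psum_def coef_scale scale_sum_right)

lemma psum_diff: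
  assumes "x \<in> topspace T" "y \<in> topspace T"
  shows "psum n (x - y) = psum n x - psum n y"
  using psum_add[of "x - y" y n] assms topspace_diff by simp

lemma psum_limit: "x \<in> topspace T \<Longrightarrow> limitin T (\<lambda>n. psum n x) x sequentially"
  using coef_expansion by (simp add: basis_expansion_def psum_def)

end

text \<open>A Schauder basis of a complete space with an invariant metric, as every step of an LF-space
  with a stepwise basis provides.\<close>

locale metric_schauder = invariant_metric_tvs scl T d + schauder_tvs scl T e
  for scl :: "'k::{real_normed_field,banach} \<Rightarrow> 'a::ab_group_add \<Rightarrow> 'a"
    and T :: "'a topology" and d :: "'a \<Rightarrow> 'a \<Rightarrow> real" and e :: "nat \<Rightarrow> 'a"
begin

text \<open>The balls around \<open>0\<close> for the finer size function \<open>sup\<^sub>n nrm (psum n x)\<close>.\<close>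

definition pball :: "real \<Rightarrow> 'a set" where
  "pball r = {x \<in> X. \<forall>n. nrm (psum n x) \<le> r}"

lemma pball_diff:
  assumes "x \<in> pball r" "y \<in> pball s"
  shows "x - y \<in> pball (r + s)"
proof -
  have "nrm (psum n (x - y)) \<le> r + s" for n
    using assms nrm_diff[OF psum_in psum_in, of n x n y]
    by (simp add: pball_def psum_diff) (smt (verit))
  then show ?thesis using assms topspace_diff by (auto simp: pball_def)
qed

text \<open>The Baire category step: the closure of every such ball is a neighbourhood of \<open>0\<close>. The
  multiples of a ball cover the space because the partial sums of each vector converge, and hence
  form a bounded set.\<close>

lemma pball_closure_neighbourhood:
  assumes "\<epsilon> > 0"
  obtains \<delta> where "\<delta> > 0"
    "\<And>y \<eta>. y \<in> X \<Longrightarrow> nrm y < \<delta> \<Longrightarrow> \<eta> > 0 \<Longrightarrow> \<exists>z\<in>pball \<epsilon>. nrm (y - z) < \<eta>"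
proof -
  define F where "F k = {x \<in> X. scl (inverse (of_nat (Suc k))) x \<in> pball (\<epsilon> / 2)}" for k :: nat
  have cover: "\<exists>k. x \<in> F k" if x: "x \<in> X" for x
  proof -
    obtain \<eta> where \<eta>: "\<eta> > 0" "\<forall>n c. norm c < \<eta> \<longrightarrow> nrm (scl c (psum n x)) < \<epsilon> / 2"
      using convergent_bounded[OF psum_limit[OF x] psum_in, of "\<epsilon> / 2"] assms by auto
    obtain k where "inverse (real (Suc k)) < \<eta>"
      using reals_Archimedean[OF \<eta>(1)] by blast
    then have "norm (inverse (of_nat (Suc k) :: 'k)) < \<eta>"
      by (simp add: norm_inverse del: of_nat_Suc)
    with \<eta>(2) have "x \<in> F k"
      using x topspace_scale
      by (auto simp: F_def pball_def psum_scale simp del: of_nat_Suc intro!: less_imp_le)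
    then show ?thesis ..
  qed
  have "\<exists>k. T interior_of (T closure_of F k) \<noteq> {}"
  proof (rule ccontr)
    assume "\<not> ?thesis"
    then have "mtopology interior_of \<Union>(range (\<lambda>k. T closure_of F k)) = {}"
      by (intro metric_Baire_category_alt mcomplete) (auto simp: mtopology_eq)
    moreover have "X \<subseteq> \<Union>(range (\<lambda>k. T closure_of F k))"
      using cover closure_of_subset[of "F _" T] by (fastforce simp: F_def)
    then have "\<Union>(range (\<lambda>k. T closure_of F k)) = X"
      using closure_of_subset_topspace by fast
    ultimately show False
      using topspace_0 by (simp add: mtopology_eq)
  qed
  then obtain k x0 where "x0 \<in> T interior_of (T closure_of F k)" by blast
  then obtain U where U: "openin T U" "x0 \<in> U" "U \<subseteq> T closure_of F k"
    by (auto simp: interior_of_def)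
  then have x0: "x0 \<in> X" by (auto simp: openin_nrm)
  obtain r where r: "r > 0" "\<And>y. y \<in> X \<Longrightarrow> nrm (y - x0) < r \<Longrightarrow> y \<in> T closure_of F k"
    using U unfolding openin_nrm by blast
  \<comment> \<open>the closure of \<open>F k\<close> contains a ball around \<open>x0\<close>; differences of points of \<open>F k\<close> then
    approximate all small vectors\<close>
  have approx: "\<exists>u\<in>F k. nrm (y - u) < \<rho>" if y: "y \<in> X" "nrm (y - x0) < r" and "\<rho> > 0" for y \<rho>
  proof -
    have "y \<in> mtopology closure_of F k" using r(2) y by (simp only: mtopology_eq)
    then obtain u where "u \<in> F k" "u \<in> X" "d y u < \<rho>"
      using \<open>\<rho> > 0\<close> unfolding metric_closure_of by auto
    then show ?thesis using d_eq_nrm y(1) by auto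
  qed
  define K :: 'k where "K = of_nat (Suc k)"
  have K: "K \<noteq> 0" unfolding K_def by (simp del: of_nat_Suc)
  obtain \<delta> where \<delta>: "\<delta> > 0" "\<And>y. y \<in> X \<Longrightarrow> nrm y < \<delta> \<Longrightarrow> nrm (scl K y) < r"
    using bounded_scale[of "norm K" r] r(1) K by (metis order_refl zero_less_norm_iff)
  have "\<exists>z\<in>pball \<epsilon>. nrm (y - z) < \<eta>" if y: "y \<in> X" "nrm y < \<delta>" and "\<eta> > 0" for y \<eta>
  proof -
    obtain \<rho> where \<rho>: "\<rho> > 0" "\<And>y. y \<in> X \<Longrightarrow> nrm y < \<rho> \<Longrightarrow> nrm (scl (inverse K) y) < \<eta>"
      using bounded_scale[of "norm (inverse K)" \<eta>] \<open>\<eta> > 0\<close> K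
      by (metis order_refl zero_less_norm_iff nonzero_imp_inverse_nonzero)
    obtain u where u: "u \<in> F k" "nrm (x0 + scl K y - u) < \<rho> / 2"
      using approx[of "x0 + scl K y" "\<rho> / 2"] x0 y \<delta>(2) \<rho>(1) topspace_add topspace_scale by auto
    obtain v where v: "v \<in> F k" "nrm (x0 - v) < \<rho> / 2"
      using approx[of x0 "\<rho> / 2"] x0 r(1) \<rho>(1) by auto
    define z where "z = scl (inverse K) u - scl (inverse K) v"
    have uv: "u \<in> X" "v \<in> X" using u v by (auto simp: F_def)
    have "z \<in> pball (\<epsilon> / 2 + \<epsilon> / 2)"
      unfolding z_def using u(1) v(1) by (intro pball_diff) (auto simp: F_def K_def)
    moreover have "nrm (scl (inverse K) ((x0 + scl K y - u) - (x0 - v))) < \<eta>"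
      using nrm_diff[of "x0 + scl K y - u" "x0 - v"] u v uv x0 y
      by (intro \<rho>(2) topspace_diff topspace_add topspace_scale) (auto simp: topspace_diff topspace_add topspace_scale)
    moreover have "scl (inverse K) ((x0 + scl K y - u) - (x0 - v)) = y - z"
      using K by (simp add: z_def scale_right_diff_distrib scale_right_distrib algebra_simps)
    ultimately show ?thesis by auto
  qed
  with \<delta>(1) show thesis using that by blast
qed

text \<open>Passing from the closure to the ball itself uses completeness. The vector is written as the
  limit of \<open>Z K\<close>, whose increments lie in the balls of radius \<open>\<epsilon> / 2 ^ (K + 1)\<close>; the limits
  \<open>w n\<close> of \<open>psum n (Z K)\<close> are the partial sums of an expansion of that vector, so uniqueness of
  coefficients identifies them.\<close>

lemma psum_equicontinuous:
  assumes "\<epsilon> > 0"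
  obtains \<delta> where "\<delta> > 0" "\<And>y n. y \<in> X \<Longrightarrow> nrm y < \<delta> \<Longrightarrow> nrm (psum n y) \<le> \<epsilon>"
proof -
  define \<epsilon>' where "\<epsilon>' k = \<epsilon> / 2 ^ Suc k" for k :: nat
  have "\<exists>\<delta>>0. \<forall>y\<in>X. nrm y < \<delta> \<longrightarrow> (\<forall>\<eta>>0. \<exists>z\<in>pball (\<epsilon>' k). nrm (y - z) < \<eta>)" for k
    using pball_closure_neighbourhood[of "\<epsilon>' k"] assms by (auto simp: \<epsilon>'_def) metis
  then obtain \<delta>' where \<delta>': "\<And>k. \<delta>' k > 0"
    "\<And>k y \<eta>. y \<in> X \<Longrightarrow> nrm y < \<delta>' k \<Longrightarrow> \<eta> > 0 \<Longrightarrow> \<exists>z\<in>pball (\<epsilon>' k). nrm (y - z) < \<eta>"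
    by metis
  define \<delta> where "\<delta> k = min (\<delta>' k) (1 / 2 ^ k)" for k
  have \<delta>_pos: "\<delta> k > 0" for k using \<delta>'(1) by (simp add: \<delta>_def)
  have "nrm (psum n y) \<le> \<epsilon>" if y: "y \<in> X" "nrm y < \<delta> 0" for y n
  proof -
    have "\<exists>Z. \<forall>k. (Z k \<in> X \<and> nrm (y - Z k) < \<delta> k \<and> (k = 0 \<longrightarrow> Z k = 0)) \<and> Z (Suc k) - Z k \<in> pball (\<epsilon>' k)"
    proof (rule dependent_nat_choice)
      show "\<exists>x. x \<in> X \<and> nrm (y - x) < \<delta> 0 \<and> (0 = (0::nat) \<longrightarrow> x = 0)"
        using y topspace_0 by auto
    next
      fix x k assume "x \<in> X \<and> nrm (y - x) < \<delta> k \<and> (k = 0 \<longrightarrow> x = 0)"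
      then have x: "x \<in> X" "nrm (y - x) < \<delta>' k" by (auto simp: \<delta>_def)
      then obtain z where z: "z \<in> pball (\<epsilon>' k)" "nrm (y - x - z) < \<delta> (Suc k)"
        using \<delta>'(2)[of "y - x" k "\<delta> (Suc k)"] y(1) topspace_diff \<delta>_pos by blast
      then show "\<exists>x'. (x' \<in> X \<and> nrm (y - x') < \<delta> (Suc k) \<and> (Suc k = 0 \<longrightarrow> x' = 0)) \<and> x' - x \<in> pball (\<epsilon>' k)"
        using x(1) topspace_add by (intro exI[of _ "x + z"]) (auto simp: pball_def algebra_simps)
    qed
    then obtain Z where Z: "\<And>k. Z k \<in> X" "\<And>k. nrm (y - Z k) < \<delta> k" "Z 0 = 0"
      "\<And>k. Z (Suc k) - Z k \<in> pball (\<epsilon>' k)" by blast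
    \<comment> \<open>the bound is the telescoping sum of the radii \<open>\<epsilon>' k, \<dots>, \<epsilon>' (l - 1)\<close>\<close>
    have inc: "nrm (psum n (Z l) - psum n (Z k)) \<le> \<epsilon> / 2 ^ k - \<epsilon> / 2 ^ l" if "k \<le> l" for k l n
      using that
    proof (induction l rule: dec_induct)
      case (step l)
      have "nrm (psum n (Z (Suc l)) - psum n (Z k)) =
          nrm (psum n (Z (Suc l) - Z l) + (psum n (Z l) - psum n (Z k)))"
        by (simp add: psum_diff Z(1))
      also have "\<dots> \<le> nrm (psum n (Z (Suc l) - Z l)) + nrm (psum n (Z l) - psum n (Z k))"
        by (intro nrm_add psum_in topspace_diff)
      also have "\<dots> \<le> \<epsilon>' l + (\<epsilon> / 2 ^ k - \<epsilon> / 2 ^ l)"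
      proof (rule add_mono)
        show "nrm (psum n (Z (Suc l) - Z l)) \<le> \<epsilon>' l"
          using Z(4)[of l] by (simp add: pball_def)
      qed (rule step.IH)
      finally show ?case by (simp add: \<epsilon>'_def field_simps)
    qed simp
    have tail: "\<exists>N. \<epsilon> / 2 ^ N < r" if "r > 0" for r
    proof -
      obtain N where "inverse 2 ^ N < r / \<epsilon>"
        using real_arch_pow_inv[of "r / \<epsilon>" "inverse 2"] \<open>r > 0\<close> assms by auto
      then show ?thesis using assms by (auto simp: field_simps power_inverse)
    qed
    have inc': "nrm (psum n (Z l) - psum n (Z k)) \<le> \<epsilon> / 2 ^ N" if "k \<ge> N" "l \<ge> N" for k l n N
    proof -
      have *: "nrm (psum n (Z l) - psum n (Z k)) \<le> \<epsilon> / 2 ^ N" if "k \<le> l" "k \<ge> N" for k l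
      proof -
        have "\<epsilon> / 2 ^ k \<le> \<epsilon> / 2 ^ N" and "\<epsilon> / 2 ^ l \<ge> 0"
          using that assms by (auto intro!: divide_left_mono power_increasing)
        then show ?thesis using inc[OF that(1), of n] by linarith
      qed
      show ?thesis
      proof (cases "k \<le> l")
        case False
        then show ?thesis
          using *[of l k] that nrm_minus_commute[OF psum_in psum_in, of n "Z l" n "Z k"] by simp
      qed (use * that in auto)
    qed
    have "\<exists>w. limitin T (\<lambda>k. psum n (Z k)) w sequentially" for n
    proof (rule Cauchy_nrm_limit)
      fix r :: real assume "r > 0"
      then obtain N where "\<epsilon> / 2 ^ N < r" using tail by blast
      then show "\<exists>N. \<forall>k\<ge>N. \<forall>l\<ge>N. nrm (psum n (Z k) - psum n (Z l)) < r"
        using inc'[of N] by (meson le_less_trans)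
    qed (auto simp: psum_in)
    then obtain w where w: "\<And>n. limitin T (\<lambda>k. psum n (Z k)) (w n) sequentially" by metis
    have w_in: "w n \<in> X" for n using w by (simp add: limitin_nrm)
    have w_tail: "nrm (w n - psum n (Z N)) \<le> \<epsilon> / 2 ^ N" for n N
    proof (rule field_le_epsilon)
      fix r :: real assume "r > 0"
      then have "\<forall>\<^sub>F k in sequentially. nrm (psum n (Z k) - w n) < r"
        by (intro limitin_nrm_less w)
      then obtain k where k: "k \<ge> N" "nrm (psum n (Z k) - w n) < r"
        unfolding eventually_sequentially by (meson nle_le)
      have "nrm ((w n - psum n (Z k)) + (psum n (Z k) - psum n (Z N))) \<le> r + \<epsilon> / 2 ^ N"
        using nrm_add[of "w n - psum n (Z k)" "psum n (Z k) - psum n (Z N)"]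
          k inc'[of N N k n] nrm_minus_commute[of "w n" "psum n (Z k)"] w_in psum_in topspace_diff
        by force
      then show "nrm (w n - psum n (Z N)) \<le> \<epsilon> / 2 ^ N + r" by simp
    qed
    have uniq: "l = l'" if "limitin T f l sequentially" "limitin T f l' sequentially" for f l l'
      using limitin_metric_unique[of f l sequentially l'] that by (simp add: mtopology_eq)
    have w0: "w 0 = 0"
      using uniq[OF w[of 0], of 0] topspace_0 by (simp add: psum_def)
    \<comment> \<open>the line spanned by a basis vector is closed, since its scalars form a Cauchy sequence
      whenever its points do\<close>
    have "\<exists>c. w (Suc n) - w n = scl c (e (Suc n))" for n
    proof -
      define C where "C k = coef (Z k) (Suc n)" for k
      have C: "psum (Suc n) (Z k) - psum n (Z k) = scl (C k) (e (Suc n))" for k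
        by (simp add: psum_Suc C_def)
      have en: "e (Suc n) \<in> X" "nrm (e (Suc n)) > 0"
        using e_in e_nonzero nrm_pos by auto
      have "Cauchy C"
      proof (rule CauchyI)
        fix r :: real assume "r > 0"
        then obtain \<rho> where \<rho>: "\<rho> > 0"
          "\<And>c y. y \<in> X \<Longrightarrow> nrm y \<ge> nrm (e (Suc n)) \<Longrightarrow> nrm (scl c y) < \<rho> \<Longrightarrow> norm c < r"
          using scalar_small[OF en(2)] by blast
        obtain N where N: "\<epsilon> / 2 ^ N < \<rho> / 2" using tail[of "\<rho> / 2"] \<rho>(1) by auto
        have "norm (C k - C l) < r" if "k \<ge> N" "l \<ge> N" for k l
        proof (rule \<rho>(2)[OF en(1) order_refl])
          have "nrm (scl (C k - C l) (e (Suc n))) =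
              nrm ((psum (Suc n) (Z k) - psum (Suc n) (Z l)) - (psum n (Z k) - psum n (Z l)))"
            by (simp add: scale_left_diff_distrib C[symmetric] algebra_simps)
          also have "\<dots> \<le> nrm (psum (Suc n) (Z k) - psum (Suc n) (Z l)) + nrm (psum n (Z k) - psum n (Z l))"
            by (intro nrm_diff topspace_diff psum_in)
          also have "\<dots> < \<rho>"
            using inc'[OF that(2,1), of "Suc n"] inc'[OF that(2,1), of n] N by linarith
          finally show "nrm (scl (C k - C l) (e (Suc n))) < \<rho>" .
        qed
        then show "\<exists>M. \<forall>m\<ge>M. \<forall>n\<ge>M. norm (C m - C n) < r" by blast
      qed
      then obtain c where c: "C \<longlonglongrightarrow> c"
        using Cauchy_convergent_iff convergent_def by blast
      have "limitin T (\<lambda>k. scl (C k) (e (Suc n))) (scl c (e (Suc n))) sequentially"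
        by (rule limitin_scale[OF c]) (use en in simp)
      from limitin_add[OF this w[of n]]
      have "limitin T (\<lambda>k. psum (Suc n) (Z k)) (scl c (e (Suc n)) + w n) sequentially"
        by (simp add: C[symmetric])
      then have "w (Suc n) = scl c (e (Suc n)) + w n"
        by (rule uniq[OF w])
      then show ?thesis by auto
    qed
    then obtain c where c: "\<And>n. w (Suc n) - w n = scl (c n) (e (Suc n))" by metis
    have w_sum: "w n = (\<Sum>j=1..n. scl (c (j - 1)) (e j))" for n
    proof (induction n)
      case (Suc n)
      have "w (Suc n) = w n + scl (c n) (e (Suc n))"
        using c[of n] by (simp add: algebra_simps)
      with Suc show ?case by simp
    qed (simp add: w0)
    have "limitin T w y sequentially"
      unfolding limitin_nrm
    proof (intro conjI allI impI y(1))
      fix r :: real assume "r > 0"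
      obtain N1 where N1: "\<epsilon> / 2 ^ N1 < r / 3" using tail[of "r / 3"] \<open>r > 0\<close> by auto
      obtain N2 where N2: "inverse 2 ^ N2 < r / 3"
        using real_arch_pow_inv[of "r / 3" "inverse 2"] \<open>r > 0\<close> by auto
      define N where "N = max N1 N2"
      have "\<epsilon> / 2 ^ N \<le> \<epsilon> / 2 ^ N1"
        using assms by (auto simp: N_def intro!: divide_left_mono power_increasing)
      then have N: "\<epsilon> / 2 ^ N < r / 3" using N1 by linarith
      have "(1::real) / 2 ^ N \<le> 1 / 2 ^ N2"
        by (auto simp: N_def intro!: divide_left_mono power_increasing)
      moreover have "nrm (y - Z N) < 1 / 2 ^ N" using Z(2)[of N] by (simp add: \<delta>_def)
      moreover have "1 / 2 ^ N2 < r / 3" using N2 by (simp add: power_one_over inverse_eq_divide)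
      ultimately have N': "nrm (Z N - y) < r / 3"
        using nrm_minus_commute[OF y(1) Z(1)[of N]] by linarith
      have "\<forall>\<^sub>F n in sequentially. nrm (psum n (Z N) - Z N) < r / 3"
        using \<open>r > 0\<close> by (intro limitin_nrm_less psum_limit Z(1)) simp
      then show "\<forall>\<^sub>F n in sequentially. w n \<in> X \<and> nrm (w n - y) < r"
      proof eventually_elim
        case (elim n)
        have "nrm (w n - y) = nrm ((w n - psum n (Z N)) + ((psum n (Z N) - Z N) + (Z N - y)))"
          by simp
        also have "\<dots> \<le> nrm (w n - psum n (Z N)) + nrm ((psum n (Z N) - Z N) + (Z N - y))"
          by (intro nrm_add topspace_add topspace_diff w_in psum_in Z(1) y(1))
        also have "\<dots> \<le> nrm (w n - psum n (Z N)) + (nrm (psum n (Z N) - Z N) + nrm (Z N - y))"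
          by (intro add_left_mono nrm_add topspace_diff psum_in Z(1) y(1))
        also have "\<dots> < r" using w_tail[of n N] N N' elim by linarith
        finally show ?case using w_in by simp
      qed
    qed
    then have "basis_expansion scl T e (\<lambda>j. c (j - 1)) y"
      unfolding basis_expansion_def w_sum[symmetric] .
    from coef_unique[OF this] have "psum n y = w n"
      unfolding w_sum psum_def by (intro sum.cong) auto
    \<comment> \<open>the tail estimate at \<open>Z 0 = 0\<close> bounds \<open>w n\<close> itself\<close>
    moreover have "psum n (Z 0) = 0"
      by (simp add: psum_def Z(3) coef_0)
    ultimately show ?thesis
      using w_tail[of n 0] by simp
  qed
  with \<delta>_pos show thesis using that by blast
qed

text \<open>Consequently coefficients belonging to basis vectors that stay away from \<open>0\<close> form an
  equicontinuous family.\<close>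

lemma coef_equicontinuous:
  assumes "r > 0" "\<And>j. j \<in> J \<Longrightarrow> j \<ge> 1 \<and> nrm (e j) \<ge> r" "\<epsilon> > 0"
  shows "\<exists>W. openin T W \<and> 0 \<in> W \<and> (\<forall>x\<in>W. \<forall>j\<in>J. norm (coef x j) < \<epsilon>)"
proof -
  obtain \<rho> where \<rho>: "\<rho> > 0" "\<And>c y. y \<in> X \<Longrightarrow> nrm y \<ge> r \<Longrightarrow> nrm (scl c y) < \<rho> \<Longrightarrow> norm c < \<epsilon>"
    using scalar_small[OF assms(1,3)] by blast
  obtain \<delta> where \<delta>: "\<delta> > 0" "\<And>y n. y \<in> X \<Longrightarrow> nrm y < \<delta> \<Longrightarrow> nrm (psum n y) \<le> \<rho> / 3"
    using psum_equicontinuous[of "\<rho> / 3"] \<rho>(1) by auto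
  have "norm (coef x j) < \<epsilon>" if x: "x \<in> X" "nrm x < \<delta>" and j: "j \<in> J" for x j
  proof (rule \<rho>(2))
    obtain i where i: "j = Suc i" using assms(2)[OF j] by (cases j) auto
    have "nrm (scl (coef x j) (e j)) = nrm (psum (Suc i) x - psum i x)"
      by (simp add: psum_Suc i)
    also have "\<dots> \<le> nrm (psum (Suc i) x) + nrm (psum i x)"
      by (intro nrm_diff psum_in)
    also have "\<dots> < \<rho>" using \<delta>(2)[OF x, of "Suc i"] \<delta>(2)[OF x, of i] \<rho>(1) by linarith
    finally show "nrm (scl (coef x j) (e j)) < \<rho>" .
  qed (use assms(2)[OF j] e_in in auto)
  then show ?thesis
    using \<delta>(1) topspace_0 openin_nrm_ball by (intro exI[of _ "{x \<in> X. nrm x < \<delta>}"]) auto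
qed

end

section \<open>The topology of a seminorm\<close>

text \<open>The (in general not Hausdorff) topology on the subspace \<open>S\<close> defined by one seminorm \<open>q\<close>.\<close>

definition seminorm_topology :: "'a::ab_group_add set \<Rightarrow> ('a \<Rightarrow> real) \<Rightarrow> 'a topology" where
  "seminorm_topology S q =
    topology (\<lambda>U. U \<subseteq> S \<and> (\<forall>x\<in>U. \<exists>r>0. \<forall>y\<in>S. q (y - x) < r \<longrightarrow> y \<in> U))"

lemma openin_seminorm_topology:
  "openin (seminorm_topology S q) U \<longleftrightarrow>
    U \<subseteq> S \<and> (\<forall>x\<in>U. \<exists>r>0. \<forall>y\<in>S. q (y - x) < r \<longrightarrow> y \<in> U)"
proof -
  have "istopology (\<lambda>U. U \<subseteq> S \<and> (\<forall>x\<in>U. \<exists>r>0. \<forall>y\<in>S. q (y - x) < r \<longrightarrow> y \<in> U))"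
    unfolding istopology_def
  proof (intro conjI allI impI ballI)
    fix U V x
    assume U: "U \<subseteq> S \<and> (\<forall>x\<in>U. \<exists>r>0. \<forall>y\<in>S. q (y - x) < r \<longrightarrow> y \<in> U)"
      and V: "V \<subseteq> S \<and> (\<forall>x\<in>V. \<exists>r>0. \<forall>y\<in>S. q (y - x) < r \<longrightarrow> y \<in> V)"
    then show "U \<inter> V \<subseteq> S" by blast
    assume "x \<in> U \<inter> V"
    then obtain r s where "r > 0" "s > 0" "\<forall>y\<in>S. q (y - x) < r \<longrightarrow> y \<in> U"
      "\<forall>y\<in>S. q (y - x) < s \<longrightarrow> y \<in> V"
      using U V by blast
    then show "\<exists>r>0. \<forall>y\<in>S. q (y - x) < r \<longrightarrow> y \<in> U \<inter> V"
      by (intro exI[of _ "min r s"]) auto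
  next
    fix \<K> assume K: "\<forall>K\<in>\<K>. K \<subseteq> S \<and> (\<forall>x\<in>K. \<exists>r>0. \<forall>y\<in>S. q (y - x) < r \<longrightarrow> y \<in> K)"
    then show "\<Union>\<K> \<subseteq> S" by blast
    fix x assume "x \<in> \<Union>\<K>"
    then obtain A where A: "A \<in> \<K>" "x \<in> A" by blast
    then obtain r where "r > 0" "\<forall>y\<in>S. q (y - x) < r \<longrightarrow> y \<in> A"
      using K by blast
    with A(1) show "\<exists>r>0. \<forall>y\<in>S. q (y - x) < r \<longrightarrow> y \<in> \<Union>\<K>" by blast
  qed
  then show ?thesis by (simp add: seminorm_topology_def)
qed

lemma topspace_seminorm_topology [simp]: "topspace (seminorm_topology S q) = S"
proof
  have "openin (seminorm_topology S q) S"
    unfolding openin_seminorm_topology by (auto intro: exI[of _ 1])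
  then show "S \<subseteq> topspace (seminorm_topology S q)" by (rule openin_subset)
  show "topspace (seminorm_topology S q) \<subseteq> S"
    using openin_topspace[of "seminorm_topology S q"] unfolding openin_seminorm_topology by blast
qed

text \<open>A seminorm on a subspace; the inequality for scalar multiples implies equality.\<close>

locale seminorm = vector_space scl
  for scl :: "'k::{real_normed_field,banach} \<Rightarrow> 'a::ab_group_add \<Rightarrow> 'a" +
  fixes S :: "'a set" and q :: "'a \<Rightarrow> real"
  assumes S: "subspace S"
    and q_nonneg: "x \<in> S \<Longrightarrow> 0 \<le> q x"
    and q_add: "x \<in> S \<Longrightarrow> y \<in> S \<Longrightarrow> q (x + y) \<le> q x + q y"
    and q_scale: "x \<in> S \<Longrightarrow> q (scl c x) \<le> norm c * q x"
begin

lemma q_0: "q 0 = 0"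
  using q_scale[of 0 0] q_nonneg[of 0] subspace_0[OF S] by simp

lemma openin_seminorm_ball:
  assumes "a \<in> S"
  shows "openin (seminorm_topology S q) {x \<in> S. q (x - a) < r}"
  unfolding openin_seminorm_topology
proof (intro conjI ballI)
  fix x assume "x \<in> {x \<in> S. q (x - a) < r}"
  then have x: "x \<in> S" "q (x - a) < r" by auto
  have "q (y - a) < r" if "y \<in> S" "q (y - x) < r - q (x - a)" for y
    using q_add[of "y - x" "x - a"] subspace_diff[OF S] that x assms by simp
  then show "\<exists>r'>0. \<forall>y\<in>S. q (y - x) < r' \<longrightarrow> y \<in> {x \<in> S. q (x - a) < r}"
    using x by (intro exI[of _ "r - q (x - a)"]) auto
qed auto

lemma locally_convex_tvs_seminorm: "locally_convex_tvs scl (seminorm_topology S q)"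
proof
  let ?T = "seminorm_topology S q"
  show "subspace (topspace ?T)" by (simp add: S)
  show "continuous_map (prod_topology ?T ?T) ?T (\<lambda>(x, y). x + y)"
    unfolding continuous_map_def
  proof (intro conjI allI impI)
    fix U assume U: "openin ?T U"
    show "openin (prod_topology ?T ?T)
        {p \<in> topspace (prod_topology ?T ?T). (case p of (x, y) \<Rightarrow> x + y) \<in> U}"
      unfolding openin_prod_topology_alt
    proof (intro allI impI)
      fix x y
      assume "(x, y) \<in> {p \<in> topspace (prod_topology ?T ?T). (case p of (x, y) \<Rightarrow> x + y) \<in> U}"
      then have xy: "x \<in> S" "y \<in> S" "x + y \<in> U" by auto
      obtain r where r: "r > 0" "\<And>z. z \<in> S \<Longrightarrow> q (z - (x + y)) < r \<Longrightarrow> z \<in> U"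
        using U xy(3) unfolding openin_seminorm_topology by blast
      have "x' + y' \<in> U" if "x' \<in> S" "q (x' - x) < r / 2" "y' \<in> S" "q (y' - y) < r / 2" for x' y'
      proof (rule r(2))
        have "q ((x' - x) + (y' - y)) < r"
          using q_add[of "x' - x" "y' - y"] subspace_diff[OF S] that xy by force
        then show "q (x' + y' - (x + y)) < r" by (simp add: algebra_simps)
      qed (use that subspace_add[OF S] in auto)
      then show "\<exists>U' V. openin ?T U' \<and> openin ?T V \<and> x \<in> U' \<and> y \<in> V \<and> U' \<times> V \<subseteq>
          {p \<in> topspace (prod_topology ?T ?T). (case p of (x, y) \<Rightarrow> x + y) \<in> U}"
        using xy r(1) q_0
        by (intro exI[of _ "{x' \<in> S. q (x' - x) < r / 2}"] exI[of _ "{y' \<in> S. q (y' - y) < r / 2}"]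
            conjI openin_seminorm_ball) auto
    qed
  qed (use subspace_add[OF S] in auto)
  show "continuous_map (prod_topology euclidean ?T) ?T (\<lambda>(c, x). scl c x)"
    unfolding continuous_map_def
  proof (intro conjI allI impI)
    fix U assume U: "openin ?T U"
    show "openin (prod_topology euclidean ?T)
        {p \<in> topspace (prod_topology euclidean ?T). (case p of (c, x) \<Rightarrow> scl c x) \<in> U}"
      unfolding openin_prod_topology_alt
    proof (intro allI impI)
      fix c x
      assume "(c, x) \<in> {p \<in> topspace (prod_topology euclidean ?T). (case p of (c, x) \<Rightarrow> scl c x) \<in> U}"
      then have cx: "x \<in> S" "scl c x \<in> U" by auto
      obtain r where r: "r > 0" "\<And>z. z \<in> S \<Longrightarrow> q (z - scl c x) < r \<Longrightarrow> z \<in> U"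
        using U cx(2) unfolding openin_seminorm_topology by blast
      define s where "s = r / 2 / (norm c + 1)"
      define t where "t = min 1 (r / 2 / (q x + 1))"
      have nc: "norm c + 1 > 0" by (simp add: add_nonneg_pos)
      have qx: "q x + 1 > 0" using q_nonneg[OF cx(1)] by simp
      have s: "s > 0" and t: "t > 0" using r(1) nc qx by (simp_all add: s_def t_def)
      have "scl c' x' \<in> U" if c': "dist c' c < t" and x': "x' \<in> S" "q (x' - x) < s" for c' x'
      proof (rule r(2))
        have "norm c' \<le> norm c + norm (c' - c)" using norm_triangle_sub by blast
        then have c'_le: "norm c' \<le> norm c + 1" using c' by (simp add: t_def dist_norm)
        have "q (scl c' (x' - x)) \<le> norm c' * q (x' - x)"
          using x' cx subspace_diff[OF S] by (intro q_scale) auto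
        also have "\<dots> \<le> (norm c + 1) * q (x' - x)"
          using c'_le x' cx subspace_diff[OF S] by (intro mult_right_mono q_nonneg) auto
        also have "\<dots> < (norm c + 1) * s"
          using x'(2) nc by (intro mult_strict_left_mono)
        also have "\<dots> = r / 2" using nc unfolding s_def by (metis less_irrefl nonzero_mult_div_cancel_left times_divide_eq_right)
        finally have 1: "q (scl c' (x' - x)) < r / 2" .
        have "q (scl (c' - c) x) \<le> norm (c' - c) * q x"
          using cx by (intro q_scale)
        also have "\<dots> \<le> norm (c' - c) * (q x + 1)"
          by (intro mult_left_mono) auto
        also have "\<dots> < r / 2 / (q x + 1) * (q x + 1)"
          using c' qx by (intro mult_strict_right_mono) (auto simp: t_def dist_norm)
        also have "\<dots> = r / 2" using qx by (metis less_irrefl nonzero_eq_divide_eq)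
        finally have 2: "q (scl (c' - c) x) < r / 2" .
        have "q (scl c' (x' - x) + scl (c' - c) x) < r"
          using q_add[of "scl c' (x' - x)" "scl (c' - c) x"] 1 2
            subspace_scale[OF S] subspace_diff[OF S] x' cx by force
        then show "q (scl c' x' - scl c x) < r"
          by (simp add: scale_right_diff_distrib scale_left_diff_distrib)
      qed (use x' subspace_scale[OF S] in auto)
      then show "\<exists>U' V. openin euclidean U' \<and> openin ?T V \<and> c \<in> U' \<and> x \<in> V \<and> U' \<times> V \<subseteq>
          {p \<in> topspace (prod_topology euclidean ?T). (case p of (c, x) \<Rightarrow> scl c x) \<in> U}"
        using cx s t q_0
        by (intro exI[of _ "ball c t"] exI[of _ "{x' \<in> S. q (x' - x) < s}"] conjI openin_seminorm_ball)
          (auto simp: dist_commute)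
    qed
  qed (use subspace_scale[OF S] in auto)
  show "neighbourhood_base_at 0 (convex_wrt scl) ?T"
    unfolding neighbourhood_base_at_def
  proof (intro allI impI)
    fix W assume "openin ?T W \<and> 0 \<in> W"
    then obtain r where r: "r > 0" "\<And>z. z \<in> S \<Longrightarrow> q z < r \<Longrightarrow> z \<in> W"
      unfolding openin_seminorm_topology by (metis diff_zero)
    define V where "V = {x \<in> S. q (x - 0) < r}"
    have "scl (of_real u) x + scl (of_real v) y \<in> V"
      if xy: "x \<in> V" "y \<in> V" and uv: "u \<ge> 0" "v \<ge> 0" "u + v = 1" for x y u v
    proof -
      have "q (scl (of_real u) x + scl (of_real v) y) \<le> q (scl (of_real u) x) + q (scl (of_real v) y)"
        using xy by (intro q_add subspace_scale[OF S]) (auto simp: V_def)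
      also have "\<dots> \<le> u * q x + v * q y"
        using q_scale[of x "of_real u"] q_scale[of y "of_real v"] xy uv by (simp add: V_def)
      also have "\<dots> < r"
        using convex_bound_lt[of "q x" r "q y" u v] xy uv by (simp add: V_def)
      finally show ?thesis
        using xy subspace_add[OF S] subspace_scale[OF S] by (simp add: V_def)
    qed
    then have "convex_wrt scl V" by (auto simp: convex_wrt_def)
    moreover have "openin ?T V" unfolding V_def by (rule openin_seminorm_ball[OF subspace_0[OF S]])
    moreover have "0 \<in> V" "V \<subseteq> W" using r q_0 subspace_0[OF S] by (auto simp: V_def)
    ultimately show "\<exists>U V. openin ?T U \<and> convex_wrt scl V \<and> 0 \<in> U \<and> U \<subseteq> V \<and> V \<subseteq> W" by blast
  qed
qed

end

section \<open>Coefficient functionals on an LF-space\<close>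

text \<open>An LF-space with a stepwise Schauder basis.\<close>

locale lf_schauder =
  fixes scl :: "'k::{real_normed_field,banach} \<Rightarrow> 'a::ab_group_add \<Rightarrow> 'a"
    and E :: "nat \<Rightarrow> 'a topology" and T :: "'a topology" and e :: "nat \<Rightarrow> 'a"
  assumes lf: "lf_space scl E T"
    and stepwise: "stepwise_schauder_basis scl E e"
begin

lemma step_frechet: "m \<ge> 1 \<Longrightarrow> frechet_space scl (E m)"
  using lf by (simp add: lf_space_def inductive_spectrum_def)

lemma step_tvs: "m \<ge> 1 \<Longrightarrow> tvs scl (E m)"
  using step_frechet by (simp add: frechet_space_def locally_convex_tvs_def)

lemma step_schauder: "m \<ge> 1 \<Longrightarrow> schauder_tvs scl (E m) e"
  using step_tvs stepwise
  by (simp add: schauder_tvs_def schauder_tvs_axioms_def stepwise_schauder_basis_def)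

lemma step_metric_schauder:
  assumes "m \<ge> 1"
  obtains d where "metric_schauder scl (E m) d e"
proof -
  obtain d where "invariant_metric_tvs scl (E m) d"
    using frechet_space.invariant_metric[OF step_frechet[OF assms]] .
  from metric_schauder.intro[OF this step_schauder[OF assms]] show thesis by (rule that)
qed

lemma step_inclusion:
  assumes "1 \<le> m" "m \<le> n"
  shows "continuous_map (E m) (E n) (\<lambda>x. x)"
  using assms(2,1)
proof (induction n rule: dec_induct)
  case (step n)
  then have "continuous_map (E n) (E (Suc n)) (\<lambda>x. x)"
    using lf by (simp add: lf_space_def inductive_spectrum_def)
  from continuous_map_compose[OF step.IH[OF step.prems] this] show ?case
    by (simp add: o_def)
qed simp

lemma step_mono: "1 \<le> m \<Longrightarrow> m \<le> n \<Longrightarrow> topspace (E m) \<subseteq> topspace (E n)"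
  using continuous_map_image_subset_topspace[OF step_inclusion] by simp

lemma limit_inclusion: "m \<ge> 1 \<Longrightarrow> continuous_map (E m) T (\<lambda>x. x)"
  using lf by (simp add: lf_space_def inductive_limit_def)

lemma topspace_limit: "topspace T = (\<Union>m\<in>{1..}. topspace (E m))"
  using lf by (simp add: lf_space_def inductive_limit_def)

sublocale tvs scl T
  using lf by (simp add: lf_space_def inductive_limit_def locally_convex_tvs_def)

lemma limitin_inclusion:
  "m \<ge> 1 \<Longrightarrow> limitin (E m) f l F \<Longrightarrow> limitin T f l F"
  using continuous_map_limit[OF limit_inclusion] unfolding o_def by blast

lemma in_limit: "m \<ge> 1 \<Longrightarrow> x \<in> topspace (E m) \<Longrightarrow> x \<in> topspace T"
  using topspace_limit by auto

lemma obtain_step: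
  assumes "x \<in> topspace T"
  obtains m where "m \<ge> 1" "x \<in> topspace (E m)"
  using assms topspace_limit by auto

lemma obtain_step2:
  assumes "x \<in> topspace T" "y \<in> topspace T"
  obtains m where "m \<ge> 1" "x \<in> topspace (E m)" "y \<in> topspace (E m)"
proof -
  obtain m where "m \<ge> 1" "x \<in> topspace (E m)"
    using obtain_step[OF assms(1)] .
  moreover obtain n where "n \<ge> 1" "y \<in> topspace (E n)"
    using obtain_step[OF assms(2)] .
  ultimately show thesis
    using step_mono[of m "max m n"] step_mono[of n "max m n"] by (intro that[of "max m n"]) auto
qed

lemma basis_in: "j \<ge> 1 \<Longrightarrow> e j \<in> topspace T"
  using schauder_tvs.e_in[OF step_schauder[of 1]] in_limit[of 1] by simp

text \<open>The coefficients of a vector; they do not depend on the step in which it is expanded.\<close>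

definition lcoef :: "'a \<Rightarrow> nat \<Rightarrow> 'k" where
  "lcoef x = (SOME a. \<exists>m\<ge>1. basis_expansion scl (E m) e a x)"

lemma expansion_mono:
  "1 \<le> m \<Longrightarrow> m \<le> n \<Longrightarrow> basis_expansion scl (E m) e a x \<Longrightarrow> basis_expansion scl (E n) e a x"
  using continuous_map_limit[OF step_inclusion] unfolding basis_expansion_def o_def by blast

lemma lcoef_unique:
  assumes "m \<ge> 1" "basis_expansion scl (E m) e a x" "j \<ge> 1"
  shows "lcoef x j = a j"
proof -
  obtain m' where m': "m' \<ge> 1" "basis_expansion scl (E m') e (lcoef x) x"
    using someI_ex[of "\<lambda>a. \<exists>m\<ge>1. basis_expansion scl (E m) e a x"] assms
    unfolding lcoef_def by blast
  let ?n = "max m m'"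
  interpret schauder_tvs scl "E ?n" e using assms(1) by (intro step_schauder) simp
  have "basis_expansion scl (E ?n) e a x" "basis_expansion scl (E ?n) e (lcoef x) x"
    using expansion_mono assms m' by (meson max.cobounded1 max.cobounded2)+
  then show ?thesis using coef_unique assms(3) by metis
qed

lemma lcoef_eq_coef:
  assumes "m \<ge> 1" "x \<in> topspace (E m)" "j \<ge> 1"
  shows "lcoef x j = schauder_tvs.coef scl (E m) e x j"
  using lcoef_unique[OF assms(1) schauder_tvs.coef_expansion[OF step_schauder[OF assms(1)] assms(2)] assms(3)] .

lemma lcoef_add:
  assumes "x \<in> topspace T" "y \<in> topspace T" "j \<ge> 1"
  shows "lcoef (x + y) j = lcoef x j + lcoef y j"
proof -
  obtain m where m: "m \<ge> 1" "x \<in> topspace (E m)" "y \<in> topspace (E m)"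
    using obtain_step2[OF assms(1,2)] .
  interpret M: schauder_tvs scl "E m" e using m(1) by (rule step_schauder)
  show ?thesis using m assms M.topspace_add M.coef_add by (simp add: lcoef_eq_coef[of m])
qed

lemma lcoef_scale:
  assumes "x \<in> topspace T" "j \<ge> 1"
  shows "lcoef (scl c x) j = c * lcoef x j"
proof -
  obtain m where m: "m \<ge> 1" "x \<in> topspace (E m)"
    using obtain_step[OF assms(1)] .
  interpret M: schauder_tvs scl "E m" e using m(1) by (rule step_schauder)
  show ?thesis using m assms M.topspace_scale M.coef_scale by (simp add: lcoef_eq_coef[of m])
qed

lemma lcoef_diff:
  assumes "x \<in> topspace T" "y \<in> topspace T" "j \<ge> 1"
  shows "lcoef (x - y) j = lcoef x j - lcoef y j"
  using lcoef_add[of "x - y" y j] assms topspace_diff by simp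

lemma lcoef_0: "j \<ge> 1 \<Longrightarrow> lcoef 0 j = 0"
  using lcoef_diff[of 0 0] topspace_0 by simp

lemma lcoef_basis: "i \<ge> 1 \<Longrightarrow> j \<ge> 1 \<Longrightarrow> lcoef (e j) i = (if i = j then 1 else 0)"
  using lcoef_eq_coef[of 1 "e j" i] schauder_tvs.coef_e[OF step_schauder[of 1]]
    schauder_tvs.e_in[OF step_schauder[of 1]] by simp

lemma lcoef_sum:
  assumes "finite A" "\<And>i. i \<in> A \<Longrightarrow> f i \<in> topspace T" "j \<ge> 1"
  shows "lcoef (\<Sum>i\<in>A. f i) j = (\<Sum>i\<in>A. lcoef (f i) j)"
  using assms(1,2)
proof (induction A rule: finite_induct)
  case (insert a A)
  then show ?case using assms(3) topspace_sum[of A f] by (simp add: lcoef_add)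
qed (use assms(3) lcoef_0 in simp)

lemma basis_ne_0: "j \<ge> 1 \<Longrightarrow> e j \<noteq> 0"
  using lcoef_basis[of j j] lcoef_0[of j] by auto

text \<open>If the basis vectors with indices in \<open>J\<close> avoid a neighbourhood of \<open>0\<close> in every step, then the
  corresponding coefficient functionals are equicontinuous on the limit, although the
  neighbourhood may depend on the step. The supremum of the moduli of these coefficients is a seminorm that is continuous on every
  step, hence continuous on the limit, whose topology is the finest admissible one.\<close>

lemma lcoef_equicontinuous:
  assumes away: "\<And>m. m \<ge> 1 \<Longrightarrow> \<exists>W. openin (E m) W \<and> 0 \<in> W \<and> (\<forall>j\<in>J. e j \<notin> W)"
    and J: "J \<subseteq> {1..}" "J \<noteq> {}" and "\<epsilon> > 0"
  shows "\<exists>U. openin T U \<and> 0 \<in> U \<and> (\<forall>x\<in>U. \<forall>j\<in>J. norm (lcoef x j) < \<epsilon>)"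
proof -
  have step: "\<exists>W. openin (E m) W \<and> 0 \<in> W \<and> (\<forall>x\<in>W. \<forall>j\<in>J. norm (lcoef x j) < \<delta>)"
    if m: "m \<ge> 1" and "\<delta> > 0" for m \<delta>
  proof -
    obtain d where "metric_schauder scl (E m) d e" using step_metric_schauder[OF m] .
    then interpret M: metric_schauder scl "E m" d e .
    obtain W where W: "openin (E m) W" "0 \<in> W" "\<forall>j\<in>J. e j \<notin> W" using away m by blast
    then obtain r where r: "r > 0" "\<forall>y\<in>topspace (E m). M.nrm (y - 0) < r \<longrightarrow> y \<in> W"
      unfolding M.openin_nrm by blast
    have "j \<ge> 1 \<and> M.nrm (e j) \<ge> r" if "j \<in> J" for j
      using r(2) W(3) that J(1) M.e_in[of j] by force
    then obtain W' where W': "openin (E m) W'" "0 \<in> W'" "\<forall>x\<in>W'. \<forall>j\<in>J. norm (M.coef x j) < \<delta>"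
      using M.coef_equicontinuous[OF r(1) _ \<open>\<delta> > 0\<close>] by metis
    have "norm (lcoef x j) < \<delta>" if "x \<in> W'" "j \<in> J" for x j
    proof -
      have "x \<in> topspace (E m)" "j \<ge> 1" using that openin_subset[OF W'(1)] J(1) by auto
      from lcoef_eq_coef[OF m this] show ?thesis using W'(3) that by simp
    qed
    then show ?thesis using W' by blast
  qed
  have bdd: "bdd_above ((\<lambda>j. norm (lcoef x j)) ` J)" if x: "x \<in> topspace T" for x
  proof -
    obtain m where m: "m \<ge> 1" "x \<in> topspace (E m)" using obtain_step[OF x] .
    interpret M: schauder_tvs scl "E m" e using m(1) by (rule step_schauder)
    obtain W where W: "openin (E m) W" "0 \<in> W" "\<forall>x\<in>W. \<forall>j\<in>J. norm (lcoef x j) < 1"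
      using step[OF m(1), of 1] by auto
    have "(\<lambda>n. inverse (of_nat (Suc n)) :: 'k) \<longlonglongrightarrow> 0"
      using LIMSEQ_inverse_real_of_nat by (simp add: tendsto_iff dist_norm norm_inverse del: of_nat_Suc)
    then have "limitin (E m) (\<lambda>n. scl (inverse (of_nat (Suc n))) x) (scl 0 x) sequentially"
      using m(2) by (intro M.limitin_scale) auto
    then obtain n where n: "scl (inverse (of_nat (Suc n))) x \<in> W"
      using W unfolding limitin_sequentially by (metis scale_zero_left order_refl)
    have "norm (lcoef x j) \<le> real (Suc n)" if "j \<in> J" for j
    proof -
      have "norm (inverse (of_nat (Suc n)) * lcoef x j) < 1"
        using W(3) n that lcoef_scale[OF x, of j] J(1) by (metis atLeast_iff subsetD)
      then have "inverse (real (Suc n)) * norm (lcoef x j) < 1"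
        by (simp only: norm_mult norm_inverse norm_of_nat)
      then show ?thesis by (simp add: field_simps)
    qed
    then show ?thesis by (intro bdd_aboveI2) auto
  qed
  define q where "q x = (SUP j\<in>J. norm (lcoef x j))" for x
  have q_upper: "norm (lcoef x j) \<le> q x" if "x \<in> topspace T" "j \<in> J" for x j
    unfolding q_def using that bdd by (intro cSUP_upper)
  have q_least: "q x \<le> c" if "\<And>j. j \<in> J \<Longrightarrow> norm (lcoef x j) \<le> c" for x c
    unfolding q_def using that J(2) by (intro cSUP_least)
  interpret Q: seminorm scl "topspace T" q
  proof
    show "subspace (topspace T)" by (rule subspace_topspace)
  next
    fix x assume x: "x \<in> topspace T"
    then show "0 \<le> q x" using q_upper J(2) by (meson all_not_in_conv norm_ge_zero order_trans)
    show "q (scl c x) \<le> norm c * q x" for c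
    proof (rule q_least)
      fix j assume j: "j \<in> J"
      then have "lcoef (scl c x) j = c * lcoef x j" using x J(1) by (intro lcoef_scale) auto
      then show "norm (lcoef (scl c x) j) \<le> norm c * q x"
        using q_upper[OF x j] by (simp add: norm_mult mult_left_mono)
    qed
  next
    fix x y assume xy: "x \<in> topspace T" "y \<in> topspace T"
    show "q (x + y) \<le> q x + q y"
    proof (rule q_least)
      fix j assume j: "j \<in> J"
      then have "lcoef (x + y) j = lcoef x j + lcoef y j" using xy J(1) by (intro lcoef_add) auto
      then show "norm (lcoef (x + y) j) \<le> q x + q y"
        using q_upper[of x j] q_upper[of y j] xy j norm_triangle_ineq[of "lcoef x j" "lcoef y j"] by simp
    qed
  qed
  let ?Q = "seminorm_topology (topspace T) q"
  have "continuous_map (E m) ?Q (\<lambda>x. x)" if m: "m \<ge> 1" for m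
    unfolding continuous_map_def
  proof (intro conjI allI impI)
    show "(\<lambda>x. x) \<in> topspace (E m) \<rightarrow> topspace ?Q" using in_limit m by auto
    fix U assume U: "openin ?Q U"
    interpret M: tvs scl "E m" using m by (rule step_tvs)
    show "openin (E m) {x \<in> topspace (E m). x \<in> U}"
    proof (subst openin_subopen, intro ballI)
      fix x assume x: "x \<in> {x \<in> topspace (E m). x \<in> U}"
      then obtain r where r: "r > 0" "\<forall>y\<in>topspace T. q (y - x) < r \<longrightarrow> y \<in> U"
        using U unfolding openin_seminorm_topology by blast
      obtain W where W: "openin (E m) W" "0 \<in> W" "\<forall>x\<in>W. \<forall>j\<in>J. norm (lcoef x j) < r / 2"
        using step[OF m, of "r / 2"] r(1) by auto
      have "y \<in> U" if y: "y \<in> topspace (E m)" "y - x \<in> W" for y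
      proof -
        have "q (y - x) \<le> r / 2" using W(3) y by (intro q_least) (auto intro: less_imp_le)
        then show ?thesis using r y in_limit[OF m] by auto
      qed
      then show "\<exists>V. openin (E m) V \<and> x \<in> V \<and> V \<subseteq> {x \<in> topspace (E m). x \<in> U}"
        using x W M.openin_translation[OF W(1), of x]
        by (intro exI[of _ "{y \<in> topspace (E m). y - x \<in> W}"]) auto
    qed
  qed
  then have "openin T U" if "openin ?Q U" for U
    using lf Q.locally_convex_tvs_seminorm that topspace_limit
    unfolding lf_space_def inductive_limit_def by (metis topspace_seminorm_topology)
  then have "openin T {x \<in> topspace T. q (x - 0) < \<epsilon>}"
    using Q.openin_seminorm_ball topspace_0 by blast
  moreover have "0 \<in> {x \<in> topspace T. q (x - 0) < \<epsilon>}"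
    using topspace_0 Q.q_0 \<open>\<epsilon> > 0\<close> by simp
  ultimately show ?thesis using q_upper by (metis (no_types, lifting) diff_zero le_less_trans mem_Collect_eq)
qed

text \<open>A single nonzero basis vector always avoids some neighbourhood of \<open>0\<close>, so each coefficient
  functional is continuous on the limit.\<close>

lemma lcoef_continuous_0:
  assumes "j \<ge> 1" "\<epsilon> > 0"
  shows "\<exists>U. openin T U \<and> 0 \<in> U \<and> (\<forall>x\<in>U. norm (lcoef x j) < \<epsilon>)"
proof -
  have "\<exists>W. openin (E m) W \<and> 0 \<in> W \<and> (\<forall>i\<in>{j}. e i \<notin> W)" if m: "m \<ge> 1" for m
  proof -
    obtain d where "metric_schauder scl (E m) d e" using step_metric_schauder[OF m] .
    then interpret M: metric_schauder scl "E m" d e .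
    show ?thesis
      using M.nrm_pos[OF M.e_in basis_ne_0] M.openin_nrm_ball M.topspace_0 assms(1)
      by (intro exI[of _ "{x \<in> topspace (E m). M.nrm x < M.nrm (e j)}"]) auto
  qed
  from lcoef_equicontinuous[OF this, of \<epsilon>] assms show ?thesis by auto
qed

lemma lcoef_tendsto:
  assumes "limitin T f l F" "j \<ge> 1"
  shows "((\<lambda>n. lcoef (f n) j) \<longlongrightarrow> lcoef l j) F"
  unfolding tendsto_iff
proof (intro allI impI)
  fix r :: real assume "r > 0"
  then obtain U where U: "openin T U" "0 \<in> U" "\<forall>x\<in>U. norm (lcoef x j) < r"
    using lcoef_continuous_0 assms(2) by blast
  have l: "l \<in> topspace T" using assms(1) by (rule limitin_topspace)
  then have "l \<in> {y \<in> topspace T. y - l \<in> U}" using U(2) by simp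
  then have "\<forall>\<^sub>F n in F. f n \<in> {y \<in> topspace T. y - l \<in> U}"
    using assms(1) openin_translation[OF U(1) l] unfolding limitin_def by blast
  then show "\<forall>\<^sub>F n in F. dist (lcoef (f n) j) (lcoef l j) < r"
    by (rule eventually_mono) (use U(3) l assms(2) in \<open>auto simp: dist_norm lcoef_diff[symmetric]\<close>)
qed

text \<open>The finite linear combinations of basis vectors are dense; two vectors can be approximated
  by combinations of the same length.\<close>

lemma finite_combinations_dense:
  assumes "openin T U" "x \<in> U" "openin T V" "y \<in> V"
  obtains N a b where "N \<ge> 1" "(\<Sum>j=1..N. scl (a j) (e j)) \<in> U" "(\<Sum>j=1..N. scl (b j) (e j)) \<in> V"
proof -
  have approx: "\<exists>a. \<forall>\<^sub>F n in sequentially. (\<Sum>j=1..n. scl (a j) (e j)) \<in> U"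
    if U: "openin T U" "x \<in> U" for U x
  proof -
    obtain m where m: "m \<ge> 1" "x \<in> topspace (E m)"
      by (rule obtain_step[of x]) (use U openin_subset in blast)
    have "limitin T (\<lambda>n. \<Sum>j=1..n. scl (schauder_tvs.coef scl (E m) e x j) (e j)) x sequentially"
      using limitin_inclusion[OF m(1)] schauder_tvs.coef_expansion[OF step_schauder[OF m(1)] m(2)]
      unfolding basis_expansion_def by blast
    then show ?thesis using U unfolding limitin_def by blast
  qed
  obtain a b where "\<forall>\<^sub>F n in sequentially. (\<Sum>j=1..n. scl (a j) (e j)) \<in> U"
    "\<forall>\<^sub>F n in sequentially. (\<Sum>j=1..n. scl (b j) (e j)) \<in> V"
    using approx assms by meson
  with eventually_ge_at_top[of 1]
  have "\<forall>\<^sub>F n in sequentially. n \<ge> 1 \<and> (\<Sum>j=1..n. scl (a j) (e j)) \<in> U \<and> (\<Sum>j=1..n. scl (b j) (e j)) \<in> V"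
    by eventually_elim simp
  then obtain N where "N \<ge> 1 \<and> (\<Sum>j=1..N. scl (a j) (e j)) \<in> U \<and> (\<Sum>j=1..N. scl (b j) (e j)) \<in> V"
    unfolding eventually_sequentially by blast
  then show thesis using that by blast
qed

end

section \<open>The backward shift\<close>

text \<open>An LF-space with a stepwise Schauder basis whose backward shift \<open>B\<close> is continuous.\<close>

locale lf_shift = lf_schauder scl E T e
  for scl :: "'k::{real_normed_field,banach} \<Rightarrow> 'a::ab_group_add \<Rightarrow> 'a"
    and E :: "nat \<Rightarrow> 'a topology" and T :: "'a topology" and e :: "nat \<Rightarrow> 'a" +
  fixes B :: "'a \<Rightarrow> 'a"
  assumes shift: "backward_shift scl T e B"
begin

lemma shift_continuous: "continuous_map T T B"
  and shift_add: "x \<in> topspace T \<Longrightarrow> y \<in> topspace T \<Longrightarrow> B (x + y) = B x + B y"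
  and shift_scale: "x \<in> topspace T \<Longrightarrow> B (scl c x) = scl c (B x)"
  and shift_basis_1: "B (e 1) = 0"
  and shift_basis: "j \<ge> 2 \<Longrightarrow> B (e j) = e (j - 1)"
  using shift by (auto simp: backward_shift_def)

lemma shift_in: "x \<in> topspace T \<Longrightarrow> B x \<in> topspace T"
  using shift_continuous by (auto simp: continuous_map_def)

lemma shift_0: "B 0 = 0"
  using shift_scale[of 0 0] topspace_0 by simp

lemma pow_in: "x \<in> topspace T \<Longrightarrow> (B ^^ n) x \<in> topspace T"
  by (induction n) (auto simp: shift_in)

lemma pow_0: "(B ^^ n) 0 = 0"
  by (induction n) (auto simp: shift_0)

lemma pow_continuous: "continuous_map T T (B ^^ n)"
proof (induction n)
  case (Suc n)
  then show ?case using continuous_map_compose[OF Suc shift_continuous] by (simp add: o_def)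
qed (simp add: id_def)

lemma pow_add: "x \<in> topspace T \<Longrightarrow> y \<in> topspace T \<Longrightarrow> (B ^^ n) (x + y) = (B ^^ n) x + (B ^^ n) y"
  by (induction n) (auto simp: shift_add pow_in)

lemma pow_scale: "x \<in> topspace T \<Longrightarrow> (B ^^ n) (scl c x) = scl c ((B ^^ n) x)"
  by (induction n) (auto simp: shift_scale pow_in)

lemma pow_sum:
  assumes "finite A" "\<And>i. i \<in> A \<Longrightarrow> f i \<in> topspace T"
  shows "(B ^^ n) (\<Sum>i\<in>A. f i) = (\<Sum>i\<in>A. (B ^^ n) (f i))"
  using assms
proof (induction A rule: finite_induct)
  case (insert a A)
  then show ?case using topspace_sum[of A f] by (simp add: pow_add)
qed (simp add: pow_0)

lemma pow_basis: "j \<ge> 1 \<Longrightarrow> (B ^^ n) (e (j + n)) = e j"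
proof (induction n)
  case (Suc n)
  then show ?case using shift_basis[of "j + Suc n"] by (simp add: funpow_swap1)
qed simp

lemma pow_basis_0: assumes "1 \<le> j" "j \<le> n" shows "(B ^^ n) (e j) = 0"
proof -
  have "n = (n - j) + (1 + (j - 1))" using assms by simp
  then have "(B ^^ n) (e j) = (B ^^ (n - j)) (B ((B ^^ (j - 1)) (e (1 + (j - 1)))))"
    using assms by (metis funpow_add comp_apply funpow.simps(2) le_add_diff_inverse plus_1_eq_Suc)
  then show ?thesis using pow_basis[of 1 "j - 1"] shift_basis_1 by (simp add: pow_0)
qed

text \<open>The shift acts on coefficients as expected. This holds for partial sums by linearity, and
  passes to the limit because \<open>B\<close> and the coefficient functionals are continuous on \<open>T\<close>.\<close>

lemma lcoef_shift:
  assumes "x \<in> topspace T" "j \<ge> 1"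
  shows "lcoef (B x) j = lcoef x (Suc j)"
proof -
  obtain m where m: "m \<ge> 1" "x \<in> topspace (E m)" using obtain_step[OF assms(1)] .
  define a where "a = schauder_tvs.coef scl (E m) e x"
  define s where "s n = (\<Sum>i=1..n. scl (a i) (e i))" for n
  have "basis_expansion scl (E m) e a x"
    unfolding a_def using schauder_tvs.coef_expansion[OF step_schauder[OF m(1)] m(2)] .
  then have lim: "limitin T s x sequentially" and a: "lcoef x (Suc j) = a (Suc j)"
    using limitin_inclusion[OF m(1)] lcoef_unique[OF m(1)] unfolding basis_expansion_def s_def by simp_all
  have s_in: "s n \<in> topspace T" for n
    unfolding s_def by (intro topspace_sum topspace_scale basis_in) auto
  have "lcoef (B (s n)) j = a (Suc j)" if n: "n \<ge> Suc j" for n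
  proof -
    have "B (s n) = (\<Sum>i=1..n. scl (a i) (B (e i)))"
      using pow_sum[of "{1..n}" "\<lambda>i. scl (a i) (e i)" 1] topspace_scale basis_in
      by (simp add: s_def shift_scale)
    then have "lcoef (B (s n)) j = lcoef (\<Sum>i=1..n. scl (a i) (B (e i))) j"
      by (rule arg_cong)
    also have "\<dots> = (\<Sum>i=1..n. lcoef (scl (a i) (B (e i))) j)"
      using assms(2) by (intro lcoef_sum topspace_scale shift_in basis_in) auto
    also have "\<dots> = (\<Sum>i=1..n. if i = Suc j then a i else 0)"
    proof (rule sum.cong[OF refl])
      fix i assume i: "i \<in> {1..n}"
      have "lcoef (B (e i)) j = (if i = Suc j then 1 else 0)"
      proof (cases "i = 1")
        case True
        then show ?thesis using shift_basis_1 lcoef_0 assms(2) by simp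
      next
        case False
        then show ?thesis using i shift_basis[of i] lcoef_basis[of j "i - 1"] assms(2) by auto
      qed
      then show "lcoef (scl (a i) (B (e i))) j = (if i = Suc j then a i else 0)"
        using i assms(2) by (simp add: lcoef_scale shift_in basis_in)
    qed
    also have "\<dots> = a (Suc j)" using n by simp
    finally show ?thesis .
  qed
  then have "(\<lambda>n. lcoef (B (s n)) j) \<longlonglongrightarrow> a (Suc j)"
    by (intro tendsto_eventually eventually_sequentiallyI[of "Suc j"])
  moreover have "(\<lambda>n. lcoef (B (s n)) j) \<longlonglongrightarrow> lcoef (B x) j"
    using lcoef_tendsto[OF continuous_map_limit[OF shift_continuous lim] assms(2)] by (simp add: o_def)
  ultimately show ?thesis using a LIMSEQ_unique by metis
qed

lemma lcoef_pow: "x \<in> topspace T \<Longrightarrow> j \<ge> 1 \<Longrightarrow> lcoef ((B ^^ n) x) j = lcoef x (j + n)"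
proof (induction n arbitrary: j)
  case (Suc n)
  then show ?case using lcoef_shift[OF pow_in[of x n], of j] by simp
qed simp

text \<open>Without a null subsequence the functionals \<open>\<lambda>x. lcoef x (n + s)\<close>, \<open>n \<in> I\<close>, are equicontinuous.
  Small vectors then have images under \<open>B ^^ n\<close> whose coefficients of index \<open>s + 1\<close> have modulus
  below \<open>1\<close>, uniformly in \<open>n \<in> I\<close>, and therefore stay away from \<open>2 e\<^bsub>s+1\<^esub>\<close>.\<close>

lemma transitive_imp_null_subsequence:
  assumes trans: "transitive_family T (\<lambda>n. B ^^ n) I" and I: "I \<subseteq> {1..}" "I \<noteq> {}"
  shows "\<exists>m\<ge>1. \<exists>j. strict_mono j \<and> range j \<subseteq> I \<and> limitin (E m) (\<lambda>k. e (j k + s)) 0 sequentially"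
proof (rule ccontr)
  assume neg: "\<not> ?thesis"
  define J where "J = (\<lambda>n. n + s) ` I"
  have J: "J \<subseteq> {1..}" "J \<noteq> {}" using I by (auto simp: J_def)
  have "\<exists>W. openin (E m) W \<and> 0 \<in> W \<and> (\<forall>j\<in>J. e j \<notin> W)" if m: "m \<ge> 1" for m
  proof -
    obtain d where "metric_schauder scl (E m) d e" using step_metric_schauder[OF m] .
    then interpret M: metric_schauder scl "E m" d e .
    have "\<exists>r>0. \<forall>n\<in>I. M.nrm (e (n + s)) \<ge> r"
      using neg m I(1) M.e_in basis_ne_0
      by (intro M.bounded_away_or_null_subsequence) (auto simp: subset_iff)
    then obtain r where "r > 0" "\<forall>n\<in>I. M.nrm (e (n + s)) \<ge> r" by blast
    then show ?thesis
      using M.openin_nrm_ball M.topspace_0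
      by (intro exI[of _ "{x \<in> topspace (E m). M.nrm x < r}"]) (auto simp: J_def not_less)
  qed
  from lcoef_equicontinuous[OF this J, of 1] obtain U
    where U: "openin T U" "0 \<in> U" "\<And>x j. x \<in> U \<Longrightarrow> j \<in> J \<Longrightarrow> norm (lcoef x j) < 1" by auto
  define c where "c = scl 2 (e (Suc s))"
  have c: "c \<in> topspace T" "lcoef c (Suc s) = 2"
    by (simp_all add: c_def topspace_scale basis_in lcoef_scale lcoef_basis)
  obtain V where V: "openin T V" "0 \<in> V" "\<And>x. x \<in> V \<Longrightarrow> norm (lcoef x (Suc s)) < 1"
    using lcoef_continuous_0[of "Suc s" 1] by auto
  \<comment> \<open>the smallness of \<open>B x\<close> rather than of \<open>x\<close> is used: for \<open>s = 0\<close> the coefficient of index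
    \<open>s\<close> would not exist, whereas \<open>lcoef ((B ^^ n) x) (s + 1) = lcoef (B x) (n + s)\<close> always makes
    sense\<close>
  have "openin T {x \<in> topspace T. B x \<in> U}" "openin T {y \<in> topspace T. y - c \<in> V}"
    using openin_continuous_map_preimage[OF shift_continuous U(1)] openin_translation[OF V(1) c(1)] .
  moreover have "0 \<in> {x \<in> topspace T. B x \<in> U}" "c \<in> {y \<in> topspace T. y - c \<in> V}"
    using U(2) V(2) c(1) topspace_0 shift_0 by auto
  ultimately obtain n where n: "n \<in> I"
    "(B ^^ n) ` {x \<in> topspace T. B x \<in> U} \<inter> {y \<in> topspace T. y - c \<in> V} \<noteq> {}"
    using trans[unfolded transitive_family_def, rule_format,
        of "{x \<in> topspace T. B x \<in> U}" "{y \<in> topspace T. y - c \<in> V}"] by blast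
  then obtain x where x: "x \<in> topspace T" "B x \<in> U" "(B ^^ n) x - c \<in> V" by auto
  have "lcoef ((B ^^ n) x) (Suc s) = lcoef (B x) (n + s)"
    using lcoef_pow[OF x(1), of "Suc s" n] lcoef_shift[OF x(1), of "n + s"] n(1) I(1)
    by (auto simp: add.commute)
  then have small: "norm (lcoef ((B ^^ n) x) (Suc s)) < 1"
    using U(3)[OF x(2)] n(1) by (simp add: J_def)
  have "norm (lcoef ((B ^^ n) x) (Suc s) - 2) < 1"
    using V(3)[OF x(3)] lcoef_diff[OF pow_in[OF x(1)] c(1)] c(2) by simp
  then have "norm (2 :: 'k) < 2"
    using small norm_triangle_ineq4[of "lcoef ((B ^^ n) x) (Suc s)" "lcoef ((B ^^ n) x) (Suc s) - 2"]
    by simp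
  then show False by simp
qed

text \<open>Given \<open>u\<close> and \<open>v\<close> in the span of the first \<open>N\<close> basis vectors, \<open>v\<close> shifted forward by \<open>n \<ge> N\<close>
  and added to \<open>u\<close> gives a vector that \<open>B ^^ n\<close> maps to \<open>v\<close>; for suitable \<open>n \<in> I\<close> the added vector
  is small.\<close>

lemma null_subsequence_imp_transitive:
  assumes null: "\<And>s. \<exists>m\<ge>1. \<exists>j. strict_mono j \<and> range j \<subseteq> I \<and>
      limitin (E m) (\<lambda>k. e (j k + s)) 0 sequentially"
    and I: "I \<subseteq> {1..}"
  shows "transitive_family T (\<lambda>n. B ^^ n) I"
  unfolding transitive_family_def
proof (intro allI impI)
  fix U V assume "openin T U \<and> U \<noteq> {} \<and> openin T V \<and> V \<noteq> {}"
  then obtain N a b where N: "N \<ge> 1" and U: "(\<Sum>i=1..N. scl (a i) (e i)) \<in> U"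
    and V: "(\<Sum>i=1..N. scl (b i) (e i)) \<in> V" and "openin T U"
    using finite_combinations_dense[of U _ V] by (metis ex_in_conv)
  define u where "u = (\<Sum>i=1..N. scl (a i) (e i))"
  have u_in: "u \<in> topspace T"
    unfolding u_def by (intro topspace_sum topspace_scale basis_in) auto
  obtain m j where mj: "m \<ge> 1" "strict_mono j" "range j \<subseteq> I"
    "limitin (E m) (\<lambda>k. e (j k + N)) 0 sequentially"
    using null[of N] by blast
  have j1: "j k \<ge> 1" for k using mj(3) I by auto
  \<comment> \<open>one null sequence, for the largest offset, suffices: powers of \<open>B\<close> lower the offset\<close>
  have "limitin T (\<lambda>k. e (j k + i)) 0 sequentially" if "i \<le> N" for i
  proof -
    have "limitin T (\<lambda>k. (B ^^ (N - i)) (e (j k + N))) ((B ^^ (N - i)) 0) sequentially"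
      using continuous_map_limit[OF pow_continuous limitin_inclusion[OF mj(1,4)]] by (simp add: o_def)
    moreover have "(B ^^ (N - i)) (e (j k + N)) = e (j k + i)" for k
      using pow_basis[of "j k + i" "N - i"] j1[of k] that by simp
    ultimately show ?thesis by (simp add: pow_0)
  qed
  then have "limitin T (\<lambda>k. \<Sum>i=1..N. scl (b i) (e (j k + i))) 0 sequentially"
    using limitin_scale[OF tendsto_const] by (intro limitin_sum_0) fastforce+
  then have "limitin T (\<lambda>k. u + (\<Sum>i=1..N. scl (b i) (e (j k + i)))) (u + 0) sequentially"
    using u_in by (intro limitin_add) auto
  then have "\<forall>\<^sub>F k in sequentially. u + (\<Sum>i=1..N. scl (b i) (e (j k + i))) \<in> U"
    using U \<open>openin T U\<close> unfolding limitin_def u_def by simp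
  with eventually_ge_at_top[of N]
  have "\<forall>\<^sub>F k in sequentially. k \<ge> N \<and> u + (\<Sum>i=1..N. scl (b i) (e (j k + i))) \<in> U"
    by eventually_elim simp
  then obtain k where k: "k \<ge> N" "u + (\<Sum>i=1..N. scl (b i) (e (j k + i))) \<in> U"
    unfolding eventually_sequentially by blast
  define n where "n = j k"
  have n: "n \<ge> N" "n \<in> I" using strict_mono_imp_increasing[OF mj(2), of k] k(1) mj(3) by (auto simp: n_def)
  have "(B ^^ n) u = (\<Sum>i=1..N. (B ^^ n) (scl (a i) (e i)))"
    unfolding u_def by (intro pow_sum topspace_scale basis_in) auto
  also have "\<dots> = 0"
    using n(1) by (intro sum.neutral) (auto simp: pow_scale basis_in pow_basis_0)
  finally have 1: "(B ^^ n) u = 0" .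
  have "(B ^^ n) (\<Sum>i=1..N. scl (b i) (e (n + i))) = (\<Sum>i=1..N. (B ^^ n) (scl (b i) (e (n + i))))"
    by (intro pow_sum topspace_scale basis_in) auto
  also have "\<dots> = (\<Sum>i=1..N. scl (b i) (e i))"
    using pow_basis by (intro sum.cong) (auto simp: pow_scale basis_in add.commute)
  finally have 2: "(B ^^ n) (\<Sum>i=1..N. scl (b i) (e (n + i))) = (\<Sum>i=1..N. scl (b i) (e i))" .
  have 3: "(B ^^ n) (u + (\<Sum>i=1..N. scl (b i) (e (n + i)))) = (\<Sum>i=1..N. scl (b i) (e i))"
  proof (subst pow_add[OF u_in])
    show "(\<Sum>i=1..N. scl (b i) (e (n + i))) \<in> topspace T"
      by (intro topspace_sum topspace_scale basis_in) auto
  qed (simp only: 1 2 add_0)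
  have "u + (\<Sum>i=1..N. scl (b i) (e (n + i))) \<in> U"
    unfolding n_def by (rule k(2))
  then have "(\<Sum>i=1..N. scl (b i) (e i)) \<in> (B ^^ n) ` U"
    by (subst 3[symmetric]) (rule imageI)
  with V n(2) show "\<exists>n\<in>I. (B ^^ n) ` U \<inter> V \<noteq> {}" by blast
qed

end

section \<open>Transitivity of powers of the backward shift\<close>

theorem proposition2p4:
  fixes scl :: "'k::{real_normed_field,banach} \<Rightarrow> 'a::ab_group_add \<Rightarrow> 'a"
    and E :: "nat \<Rightarrow> 'a topology" and T :: "'a topology"
    and e :: "nat \<Rightarrow> 'a" and B :: "'a \<Rightarrow> 'a" and I :: "nat set"
  assumes "lf_space scl E T"
    and "stepwise_schauder_basis scl E e"
    and "backward_shift scl T e B"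
    and "I \<subseteq> {1..}" and "infinite I"
  shows "transitive_family T (\<lambda>n. B ^^ n) I \<longleftrightarrow>
    (\<forall>s. \<exists>m\<ge>1. \<exists>j. strict_mono j \<and> range j \<subseteq> I \<and>
       limitin (E m) (\<lambda>k. e (j k + s)) 0 sequentially)"
proof -
  interpret lf_shift scl E T e B
    using assms(1-3) by unfold_locales
  have "I \<noteq> {}" using assms(5) by auto
  then show ?thesis
    using transitive_imp_null_subsequence[of I] null_subsequence_imp_transitive[of I] assms(4) by blast
qed

end
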